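(* Let $\mathcal{F}$ be a finite degenerate family of graphs with $\beta'(\mathcal{F})\geq 2$ and $\operatorname{ex}(n,\mathcal{F})=O(n)$. Let $H=K_{\beta'(\mathcal{F})-1,\,n+1-\beta'(\mathcal{F})}$. For sufficiently large $n$, if $$\operatorname{ex}_{H}(n,\mathcal{F})< e(H)+\left\lfloor \frac{n+1-\beta'(\mathcal{F})}{2}\right\rfloor,$$ then $\mathrm{Ex_{sp}}(n,\mathcal{F})\subseteq \mathcal{G}(\mathcal{F})$.
   Context: All graphs are simple. A graph is $\mathcal{F}$-free if it contains no member of $\mathcal{F}$ as a (not necessarily induced) subgraph. $\operatorname{ex}(n,\mathcal{F})$ is the maximum number of edges of an $\mathcal{F}$-free graph on $n$ vertices and $\mathrm{Ex}(n,\mathcal{F})$ the set of $\mathcal{F}$-free $n$-vertex graphs attaining it. For a graph $G_0$, $\operatorname{ex}_{G_0}(n,\mathcal{F})$ is the maximum number of edges of an $\mathcal{F}$-free $n$-vertex graph containing $G_0$ as a subgraph, and $\mathrm{Ex}_{G_0}(n,\mathcal{F})$ the set of such graphs attaining it. $\lambda(G)$ is the largest adjacency eigenvalue of $G$; $\mathrm{Ex_{sp}}(n,\mathcal{F})$ is the set of $\mathcal{F}$-free $n$-vertex graphs with maximum spectral radius among all $\mathcal{F}$-free $n$-vertex graphs. A covering of $G$ is a vertex set meeting all edges; $\beta(G)$ is the minimum size of a covering, $\beta'(G)$ the minimum size of an independent covering ($\beta'(G)=+\infty$ if $G$ is not bipartite). $\beta(\mathcal{F})=\min_{F\in\mathcal{F}}\beta(F)$,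 $\beta'(\mathcal{F})=\min_{F\in\mathcal{F}}\beta'(F)$. $\mathcal{F}$ is degenerate if it contains a bipartite graph; it is finite degenerate if it is degenerate and the orders $|F|$, $F\in\mathcal{F}$, are bounded by a fixed constant (independent of $n$). Let $\mathcal{M}(\mathcal{F})=\{F[S]: F\in\mathcal{F},\ S \text{ a covering of } F,\ |S|<\beta'(\mathcal{F})\}$, and $\mathcal{H}(\mathcal{F})=\{K_{\beta'(\mathcal{F})}\}$ if $\beta'(\mathcal{F})=\beta(\mathcal{F})$, $\mathcal{H}(\mathcal{F})=\mathcal{M}(\mathcal{F})$ if $\beta'(\mathcal{F})>\beta(\mathcal{F})$. $\vee$ denotes join, $I_m$ the edgeless graph on $m$ vertices. Set $\mathcal{G}_0(\mathcal{F})=\{T\vee I_{n+1-\beta'(\mathcal{F})}: T\in \mathrm{Ex}(\beta'(\mathcal{F})-1,\mathcal{H}(\mathcal{F}))\}$ and $\mathcal{G}(\mathcal{F})=\bigcup_{H'\in\mathcal{G}_0(\mathcal{F})}\mathrm{Ex}_{H'}(n,\mathcal{F})$. *)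

theory Defs
  imports
    "Jordan_Normal_Form.Char_Poly"
    "HOL-Library.Extended_Nat"
    "HOL-Library.Landau_Symbols"
begin

record 'a sgraph =
  verts :: "'a set"
  edges :: "'a set set"

definition simple_graph :: "'a sgraph \<Rightarrow> bool" where
  "simple_graph G \<longleftrightarrow> finite (verts G) \<and>
     (\<forall>e\<in>edges G. \<exists>u\<in>verts G. \<exists>v\<in>verts G. u \<noteq> v \<and> e = {u, v})"

text \<open>Subgraphs (not necessarily induced) are taken up to isomorphism.\<close>

definition contains_subgraph :: "'b sgraph \<Rightarrow> 'a sgraph \<Rightarrow> bool" where
  "contains_subgraph G F \<longleftrightarrow>
     (\<exists>f. inj_on f (verts F) \<and> f ` verts F \<subseteq> verts G \<and> (\<forall>e\<in>edges F. f ` e \<in> edges G))"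

definition induced_subgraph :: "'a sgraph \<Rightarrow> 'a set \<Rightarrow> 'a sgraph" where
  "induced_subgraph G S = \<lparr>verts = S, edges = {e \<in> edges G. e \<subseteq> S}\<rparr>"

definition complete_graph :: "nat \<Rightarrow> nat sgraph" where
  "complete_graph n = \<lparr>verts = {..<n}, edges = {{u, v} | u v. u < n \<and> v < n \<and> u \<noteq> v}\<rparr>"

definition edgeless_graph :: "nat \<Rightarrow> nat sgraph" where
  "edgeless_graph n = \<lparr>verts = {..<n}, edges = {}\<rparr>"

definition join :: "'a sgraph \<Rightarrow> 'b sgraph \<Rightarrow> ('a + 'b) sgraph" where
  "join G H =
     \<lparr>verts = verts G <+> verts H,
      edges = (\<lambda>e. Inl ` e) ` edges G \<union> (\<lambda>e. Inr ` e) ` edges H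
        \<union> {{Inl u, Inr v} | u v. u \<in> verts G \<and> v \<in> verts H}\<rparr>"

definition complete_bipartite :: "nat \<Rightarrow> nat \<Rightarrow> (nat + nat) sgraph" where
  "complete_bipartite a b =
     \<lparr>verts = {..<a} <+> {..<b}, edges = {{Inl u, Inr v} | u v. u < a \<and> v < b}\<rparr>"

definition bipartite :: "'a sgraph \<Rightarrow> bool" where
  "bipartite G \<longleftrightarrow>
     (\<exists>A B. A \<union> B = verts G \<and> A \<inter> B = {} \<and> (\<forall>e\<in>edges G. \<exists>u\<in>A. \<exists>v\<in>B. e = {u, v}))"

definition covering :: "'a sgraph \<Rightarrow> 'a set \<Rightarrow> bool" where
  "covering G S \<longleftrightarrow> S \<subseteq> verts G \<and> (\<forall>e\<in>edges G. e \<inter> S \<noteq> {})"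

definition independent_set :: "'a sgraph \<Rightarrow> 'a set \<Rightarrow> bool" where
  "independent_set G S \<longleftrightarrow> S \<subseteq> verts G \<and> (\<forall>e\<in>edges G. \<not> e \<subseteq> S)"

definition beta :: "'a sgraph \<Rightarrow> enat" where
  "beta G = (INF S \<in> {S. covering G S}. enat (card S))"

text \<open>The infimum over the empty set is \<open>\<infinity>\<close>, so \<open>beta' G = \<infinity>\<close> for
  graphs that are not bipartite; see \<open>beta'_eq_infinity_iff\<close> below.\<close>

definition beta' :: "'a sgraph \<Rightarrow> enat" where
  "beta' G = (INF S \<in> {S. covering G S \<and> independent_set G S}. enat (card S))"

lemma bipartite_iff_independent_covering:
  assumes "simple_graph G"
  shows "bipartite G \<longleftrightarrow> (\<exists>S. covering G S \<and> independent_set G S)"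
proof
  assume "bipartite G"
  then obtain A B where AB: "A \<union> B = verts G" "A \<inter> B = {}"
    "\<forall>e\<in>edges G. \<exists>u\<in>A. \<exists>v\<in>B. e = {u, v}"
    unfolding bipartite_def by blast
  then have "covering G A \<and> independent_set G A"
    unfolding covering_def independent_set_def by fastforce
  then show "\<exists>S. covering G S \<and> independent_set G S" ..
next
  assume "\<exists>S. covering G S \<and> independent_set G S"
  then obtain S where S: "covering G S" "independent_set G S" by blast
  have "\<exists>u\<in>S. \<exists>v\<in>verts G - S. e = {u, v}" if e: "e \<in> edges G" for e
  proof -
    obtain u v where uv: "u \<in> verts G" "v \<in> verts G" "e = {u, v}"
      using assms e unfolding simple_graph_def by blast
    have "e \<inter> S \<noteq> {}" "\<not> e \<subseteq> S"
      using S e unfolding covering_def independent_set_def by blast+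
    with uv show ?thesis by (cases "u \<in> S") (auto simp: insert_commute)
  qed
  moreover have "S \<union> (verts G - S) = verts G" "S \<inter> (verts G - S) = {}"
    using S unfolding covering_def by auto
  ultimately show "bipartite G" unfolding bipartite_def by blast
qed

lemma beta'_eq_infinity_iff:
  assumes "simple_graph G"
  shows "beta' G = \<infinity> \<longleftrightarrow> \<not> bipartite G"
proof -
  have "beta' G = \<infinity> \<longleftrightarrow> (\<forall>S. \<not> (covering G S \<and> independent_set G S))"
    unfolding beta'_def top_enat_def[symmetric] INF_top_conv by (auto simp: top_enat_def)
  then show ?thesis using bipartite_iff_independent_covering[OF assms] by blast
qed

definition family_beta :: "'a sgraph set \<Rightarrow> enat" where
  "family_beta \<F> = (INF F \<in> \<F>. beta F)"

definition family_beta' :: "'a sgraph set \<Rightarrow> enat" where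
  "family_beta' \<F> = (INF F \<in> \<F>. beta' F)"

definition degenerate :: "'a sgraph set \<Rightarrow> bool" where
  "degenerate \<F> \<longleftrightarrow> (\<exists>F\<in>\<F>. bipartite F)"

definition finite_degenerate :: "'a sgraph set \<Rightarrow> bool" where
  "finite_degenerate \<F> \<longleftrightarrow> degenerate \<F> \<and> (\<exists>C. \<forall>F\<in>\<F>. card (verts F) \<le> C)"

text \<open>Graphs on \<open>n\<close> vertices are represented on the vertex set \<open>{..<n}\<close>; since
  \<^const>\<open>contains_subgraph\<close> is up to isomorphism, so are all the notions below.\<close>

definition free_graphs :: "nat \<Rightarrow> 'a sgraph set \<Rightarrow> nat sgraph set" where
  "free_graphs n \<F> =
     {G. simple_graph G \<and> verts G = {..<n} \<and> (\<forall>F\<in>\<F>. \<not> contains_subgraph G F)}"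

definition ex :: "nat \<Rightarrow> 'a sgraph set \<Rightarrow> nat" where
  "ex n \<F> = Max ((\<lambda>G. card (edges G)) ` free_graphs n \<F>)"

definition Ex_set :: "nat \<Rightarrow> 'a sgraph set \<Rightarrow> nat sgraph set" where
  "Ex_set n \<F> = {G \<in> free_graphs n \<F>. card (edges G) = ex n \<F>}"

definition ex_containing :: "'b sgraph \<Rightarrow> nat \<Rightarrow> 'a sgraph set \<Rightarrow> nat" where
  "ex_containing G\<^sub>0 n \<F> =
     Max ((\<lambda>G. card (edges G)) ` {G \<in> free_graphs n \<F>. contains_subgraph G G\<^sub>0})"

definition Ex_containing :: "'b sgraph \<Rightarrow> nat \<Rightarrow> 'a sgraph set \<Rightarrow> nat sgraph set" where
  "Ex_containing G\<^sub>0 n \<F> =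
     {G \<in> free_graphs n \<F>. contains_subgraph G G\<^sub>0 \<and> card (edges G) = ex_containing G\<^sub>0 n \<F>}"

text \<open>The next two definitions are meant for graphs \<open>G\<close> on the vertex set \<open>{..<n}\<close>.\<close>

definition adjacency_matrix :: "nat \<Rightarrow> nat sgraph \<Rightarrow> real mat" where
  "adjacency_matrix n G = mat n n (\<lambda>(i, j). if {i, j} \<in> edges G then 1 else 0)"

definition largest_eigenvalue :: "nat \<Rightarrow> nat sgraph \<Rightarrow> real" where
  "largest_eigenvalue n G = Max {k. eigenvalue (adjacency_matrix n G) k}"

definition Ex_sp :: "nat \<Rightarrow> 'a sgraph set \<Rightarrow> nat sgraph set" where
  "Ex_sp n \<F> = {G \<in> free_graphs n \<F>.
     \<forall>G'\<in>free_graphs n \<F>. largest_eigenvalue n G' \<le> largest_eigenvalue n G}"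

definition M_family :: "'a sgraph set \<Rightarrow> 'a sgraph set" where
  "M_family \<F> = {induced_subgraph F S | F S.
     F \<in> \<F> \<and> covering F S \<and> enat (card S) < family_beta' \<F>}"

text \<open>\<open>the_enat\<close> is only applied to \<open>family_beta' \<F>\<close>, which is finite for degenerate \<open>\<F>\<close>.\<close>

definition H_family :: "nat sgraph set \<Rightarrow> nat sgraph set" where
  "H_family \<F> =
     (if family_beta' \<F> = family_beta \<F> then {complete_graph (the_enat (family_beta' \<F>))}
      else M_family \<F>)"

definition G0_family :: "nat \<Rightarrow> nat sgraph set \<Rightarrow> (nat + nat) sgraph set" where
  "G0_family n \<F> =
     {join T (edgeless_graph (n + 1 - the_enat (family_beta' \<F>))) | T.
        T \<in> Ex_set (the_enat (family_beta' \<F>) - 1) (H_family \<F>)}"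

definition G_family :: "nat \<Rightarrow> nat sgraph set \<Rightarrow> nat sgraph set" where
  "G_family n \<F> = (\<Union>H'\<in>G0_family n \<F>. Ex_containing H' n \<F>)"

end

theory Submission
  imports Defs "HOL-Analysis.Function_Topology"
begin

text \<open>
  Let \<open>k = \<beta>' - 1\<close>, let \<open>G\<close> be spectrally extremal with eigenvalue \<open>\<lambda>\<close> and let \<open>x\<close> be a nonnegative
  eigenvector with maximum entry 1. Comparison with \<open>K\<^bsub>k,n-k\<^esub>\<close> gives \<open>\<lambda>\<^sup>2 \<ge> k(n - k)\<close>. All
  subgraphs of \<open>G\<close> have linearly many edges and no \<open>k + 1\<close> vertices have \<open>m\<close> common neighbours, for
  a constant \<open>m\<close>. Counting walks of length two therefore shows first that the number of
  vertices with \<open>x \<ge> \<sigma>\<close> is bounded, and then that there is a set \<open>L\<close> of \<open>k\<close> vertices of weight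
  close to 1 and degree close to \<open>n\<close>, all other weights being close to 0.

  A vertex outside \<open>L\<close> that is not adjacent to all of \<open>L\<close> and has few neighbours of the same
  kind can be disconnected and reattached to exactly \<open>L\<close>: no forbidden graph appears and the
  quadratic form at \<open>x\<close> grows. Hence \<open>G\<close> contains \<open>K\<^bsub>k,n-k\<^esub>\<close>.

  The edges outside \<open>L\<close> form a graph of bounded degree. If it had a large matching, then
  \<open>K\<^bsub>k,n-k\<^esub>\<close> plus a perfect matching on the large side would be free as well, against the
  hypothesis; so there are boundedly many such edges. An edge inside \<open>L\<close> has weight about 1,
  an edge outside has weight about \<open>(s / \<lambda>)\<^sup>2\<close> with \<open>s = (\<Sum>j\<in>L. x j)\<close>. So the quadratic form
  forces first the number of edges inside \<open>L\<close> and then, for the given graph on \<open>L\<close>, the number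
  of edges outside \<open>L\<close> to be maximal.
\<close>

section \<open>Spectral radius and quadratic form\<close>

definition quad_form :: "nat \<Rightarrow> (nat \<Rightarrow> nat \<Rightarrow> real) \<Rightarrow> (nat \<Rightarrow> real) \<Rightarrow> real" where
  "quad_form n a x = (\<Sum>i<n. \<Sum>j<n. a i j * x i * x j)"

lemma quad_form_perturb:
  assumes "\<And>i j. a i j = a j i" "i < n"
  shows "quad_form n a (\<lambda>j. x j + (if j = i then t else 0))
    = quad_form n a x + 2 * t * (\<Sum>j<n. a i j * x j) + t^2 * a i i"
proof -
  have "quad_form n a (\<lambda>j. x j + (if j = i then t else 0)) =
    (\<Sum>p<n. \<Sum>q<n. a p q * x p * x q + (if p = i then t * (a p q * x q) else 0)
       + (if q = i then t * (a p q * x p) else 0)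
       + (if q = i then if p = i then t^2 * a p q else 0 else 0))"
    unfolding quad_form_def
    by (intro sum.cong refl) (auto simp: algebra_simps power2_eq_square)
  also have "\<dots> = quad_form n a x + (\<Sum>p<n. if p = i then (\<Sum>q<n. t * (a p q * x q)) else 0)
      + (\<Sum>p<n. t * (a p i * x p)) + (\<Sum>p<n. if p = i then t^2 * a p i else 0)"
  proof -
    have "(\<Sum>q<n. if p = i then t * (a p q * x q) else 0)
        = (if p = i then (\<Sum>q<n. t * (a p q * x q)) else 0)" for p
      by simp
    then show ?thesis
      using assms(2) by (simp add: sum.distrib quad_form_def)
  qed
  also have "\<dots> = quad_form n a x + 2 * t * (\<Sum>j<n. a i j * x j) + t^2 * a i i"
  proof -
    have "(\<Sum>p<n. t * (a p i * x p)) = t * (\<Sum>j<n. a i j * x j)"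
      unfolding sum_distrib_left by (subst assms(1)) (rule refl)
    then show ?thesis using assms(2) by (simp add: sum_distrib_left[symmetric])
  qed
  finally show ?thesis .
qed

text \<open>At a maximiser of the Rayleigh quotient, moving coordinate \<open>i\<close> by
  \<open>t\<close> yields a term linear in \<open>t\<close> that a quadratic term must dominate for
  every \<open>t\<close>. So the linear coefficient \<open>r\<close>, which is the defect of the
  eigenvalue equation at \<open>i\<close>, vanishes.\<close>

lemma eigenvector_of_quad_form_maximal:
  assumes sym: "\<And>i j. a i j = a j i"
    and upper: "\<And>y. quad_form n a y \<le> \<mu> * (\<Sum>i<n. (y i)^2)"
    and max: "\<mu> * (\<Sum>i<n. (x i)^2) \<le> quad_form n a x"
    and i: "i < n"
  shows "(\<Sum>j<n. a i j * x j) = \<mu> * x i"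
proof -
  define r where "r = (\<Sum>j<n. a i j * x j) - \<mu> * x i"
  define s where "s = \<bar>\<mu> - a i i\<bar> + 1"
  have ineq: "2 * t * r \<le> t^2 * (\<mu> - a i i)" for t
  proof -
    let ?y = "\<lambda>j. x j + (if j = i then t else 0)"
    have "(?y j)^2 = (x j)^2 + (if j = i then 2 * t * x j + t^2 else 0)" for j
      by (simp add: power2_eq_square algebra_simps)
    then have "(\<Sum>j<n. (?y j)^2) = (\<Sum>j<n. (x j)^2) + (2 * t * x i + t^2)"
      using i by (simp add: sum.distrib)
    with upper[of ?y] max show ?thesis
      unfolding quad_form_perturb[OF sym i] r_def by (simp add: algebra_simps)
  qed
  have s: "s > 0" "\<mu> - a i i \<le> s" unfolding s_def by auto
  \<comment> \<open>Since \<open>s\<close> is positive and at least \<open>\<mu> - a i i\<close>,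
    the choice \<open>t = r / s\<close> turns the inequality into
    \<open>2 * r^2 / s \<le> r^2 / s\<close>.\<close>
  have "2 * (r / s) * r \<le> (r / s)^2 * (\<mu> - a i i)" by (rule ineq)
  also have "\<dots> \<le> (r / s)^2 * s" using s by (intro mult_left_mono) auto
  also have "\<dots> = (r / s) * r" using s by (simp add: power2_eq_square)
  finally have "r * r / s \<le> 0" by simp
  then have "r = 0" using s by (auto simp: divide_le_0_iff mult_le_0_iff)
  then show ?thesis by (simp add: r_def)
qed

lemma quad_form_scale: "quad_form n a (\<lambda>i. c * y i) = c^2 * quad_form n a y"
  by (simp add: quad_form_def sum_distrib_left power2_eq_square algebra_simps)

text \<open>A vector is a function on all naturals that is pinned to 0 from \<open>n\<close> on. The
  sphere is then a closed subset of a product of compact sets, and Tychonoff's theorem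
  applies.\<close>

lemma compact_unit_sphere_fun:
  "compact {x :: nat \<Rightarrow> real. (\<forall>i\<ge>n. x i = 0) \<and> (\<Sum>i<n. (x i)^2) = 1}"
proof -
  let ?P = "PiE UNIV (\<lambda>i. if i < n then {-1..1::real} else {0})"
  have "compactin (product_topology (\<lambda>_. euclidean) UNIV) ?P"
    by (subst compactin_PiE) auto
  then have "compact ?P" by (simp add: euclidean_product_topology)
  moreover have "continuous_on UNIV (\<lambda>x :: nat \<Rightarrow> real. \<Sum>i<n. (x i)^2)"
    by (intro continuous_intros continuous_on_product_coordinates)
  then have "closed {x :: nat \<Rightarrow> real. (\<Sum>i<n. (x i)^2) = 1}"
    by (intro closed_Collect_eq) auto
  ultimately have "compact (?P \<inter> {x. (\<Sum>i<n. (x i)^2) = 1})"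
    by (rule compact_Int_closed)
  also have "?P \<inter> {x. (\<Sum>i<n. (x i)^2) = 1} = {x. (\<forall>i\<ge>n. x i = 0) \<and> (\<Sum>i<n. (x i)^2) = 1}"
  proof -
    have "-1 \<le> x i \<and> x i \<le> 1" if "(\<Sum>i<n. (x i)^2) = 1" "i < n" for x :: "nat \<Rightarrow> real" and i
    proof -
      have "(x i)^2 \<le> (\<Sum>i<n. (x i)^2)" using that by (intro member_le_sum) auto
      with that have "\<bar>x i\<bar> \<le> 1" by (simp add: abs_square_le_1)
      then show ?thesis by linarith
    qed
    moreover have "x \<in> ?P \<longleftrightarrow> (\<forall>i<n. -1 \<le> x i \<and> x i \<le> 1) \<and> (\<forall>i\<ge>n. x i = 0)"
      for x :: "nat \<Rightarrow> real"
    proof -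
      have "x \<in> ?P \<longleftrightarrow> (\<forall>i. x i \<in> (if i < n then {-1..1} else {0}))"
        unfolding PiE_iff by simp
      also have "\<dots> \<longleftrightarrow> (\<forall>i. (i < n \<longrightarrow> -1 \<le> x i \<and> x i \<le> 1) \<and> (i \<ge> n \<longrightarrow> x i = 0))"
        by (intro all_cong1) simp
      finally show ?thesis by blast
    qed
    ultimately show ?thesis by blast
  qed
  finally show ?thesis .
qed

text \<open>A maximiser of the form on the sphere can be replaced by its entrywise absolute value,
  because nonnegative \<open>a i j\<close> make the form no smaller. The argument covers reducible
  matrices as well, so entries of \<open>x\<close> may vanish.\<close>

lemma nonneg_symmetric_perron:
  assumes sym: "\<And>i j. a i j = a j i" and nonneg: "\<And>i j. 0 \<le> a i j" and n: "0 < n"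
  obtains x \<mu> where "\<And>i. 0 \<le> x i" "(\<Sum>i<n. (x i)^2) = 1"
    "\<And>y. quad_form n a y \<le> \<mu> * (\<Sum>i<n. (y i)^2)"
    "\<And>i. i < n \<Longrightarrow> (\<Sum>j<n. a i j * x j) = \<mu> * x i"
proof -
  define S where "S = {x :: nat \<Rightarrow> real. (\<forall>i\<ge>n. x i = 0) \<and> (\<Sum>i<n. (x i)^2) = 1}"
  have "(\<Sum>i<n. ((if i = 0 then 1 else 0) :: real)^2) = (\<Sum>i<n. if i = 0 then 1 else 0)"
    by (intro sum.cong) auto
  also have "\<dots> = 1" using n by simp
  finally have "(\<lambda>i. if i = 0 then 1 else 0) \<in> S"
    unfolding S_def using n by (intro CollectI conjI) simp_all
  then have "S \<noteq> {}" by blast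
  moreover have "continuous_on S (quad_form n a)"
  proof -
    have "continuous_on UNIV (\<lambda>x. \<Sum>i<n. \<Sum>j<n. a i j * x i * x j)"
      by (intro continuous_intros continuous_on_product_coordinates)
    then show ?thesis unfolding quad_form_def by (rule continuous_on_subset) simp
  qed
  ultimately obtain z where z: "z \<in> S" "\<And>y. y \<in> S \<Longrightarrow> quad_form n a y \<le> quad_form n a z"
    using continuous_attains_sup[OF compact_unit_sphere_fun[of n, folded S_def]] by blast
  define x where "x = (\<lambda>i. \<bar>z i\<bar>)"
  define \<mu> where "\<mu> = quad_form n a z"
  have xS: "(\<Sum>i<n. (x i)^2) = 1" using z(1) by (simp add: x_def S_def)
  have upper: "quad_form n a y \<le> \<mu> * (\<Sum>i<n. (y i)^2)" for y
  proof (cases "(\<Sum>i<n. (y i)^2) = 0")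
    case True
    then have "\<forall>i<n. y i = 0" by (simp add: sum_nonneg_eq_0_iff)
    with True show ?thesis by (simp add: quad_form_def)
  next
    case False
    define s where "s = sqrt (\<Sum>i<n. (y i)^2)"
    have s2: "s^2 = (\<Sum>i<n. (y i)^2)" by (simp add: s_def sum_nonneg)
    with False have s0: "s \<noteq> 0" by auto
    let ?y = "\<lambda>i. if i < n then (1/s) * y i else 0"
    have "(\<Sum>i<n. (?y i)^2) = (\<Sum>i<n. (y i)^2) / s^2"
      by (simp add: power_divide sum_divide_distrib)
    also have "\<dots> = 1" using False by (simp add: s2)
    finally have "?y \<in> S" unfolding S_def by (intro CollectI conjI) simp_all
    then have "quad_form n a ?y \<le> \<mu>" using z(2) \<mu>_def by blast
    moreover have "quad_form n a ?y = quad_form n a (\<lambda>i. (1/s) * y i)"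
      by (simp add: quad_form_def)
    ultimately have "quad_form n a y / s^2 \<le> \<mu>"
      unfolding quad_form_scale by (simp add: power_divide)
    then show ?thesis using s0 by (simp add: s2[symmetric] divide_le_eq mult.commute)
  qed
  have "quad_form n a z \<le> quad_form n a x"
    unfolding quad_form_def x_def
  proof (intro sum_mono)
    fix i j
    have "a i j * z i * z j \<le> \<bar>a i j * z i * z j\<bar>" by simp
    also have "\<dots> = a i j * \<bar>z i\<bar> * \<bar>z j\<bar>" using nonneg by (simp add: abs_mult)
    finally show "a i j * z i * z j \<le> a i j * \<bar>z i\<bar> * \<bar>z j\<bar>" .
  qed
  then have "\<mu> * (\<Sum>i<n. (x i)^2) \<le> quad_form n a x" by (simp add: xS \<mu>_def)
  from eigenvector_of_quad_form_maximal[OF sym upper this]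
  have "\<And>i. i < n \<Longrightarrow> (\<Sum>j<n. a i j * x j) = \<mu> * x i" .
  moreover have "\<And>i. 0 \<le> x i" by (simp add: x_def)
  ultimately show ?thesis using that xS upper by blast
qed

section \<open>Neighbourhoods and sums over edges\<close>

definition nbrs :: "'a sgraph \<Rightarrow> 'a \<Rightarrow> 'a set" where
  "nbrs G v = {w. {v, w} \<in> edges G}"

lemma nbrs_sym: "w \<in> nbrs G v \<longleftrightarrow> v \<in> nbrs G w"
  by (simp add: nbrs_def insert_commute)

lemma simple_graph_edge:
  assumes "simple_graph G" "{u, v} \<in> edges G"
  shows "u \<in> verts G" "v \<in> verts G" "u \<noteq> v"
proof -
  obtain a b where "a \<in> verts G" "b \<in> verts G" "a \<noteq> b" "{u, v} = {a, b}"
    using assms unfolding simple_graph_def by blast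
  then show "u \<in> verts G" "v \<in> verts G" "u \<noteq> v" by (auto simp: doubleton_eq_iff)
qed

lemma simple_graphE:
  assumes "simple_graph G" "e \<in> edges G"
  obtains u v where "u \<in> verts G" "v \<in> verts G" "u \<noteq> v" "e = {u, v}"
  using assms unfolding simple_graph_def by metis

lemma nbrs_simple:
  assumes "simple_graph G"
  shows "nbrs G v \<subseteq> verts G" "v \<notin> nbrs G v" "finite (nbrs G v)"
proof -
  show *: "nbrs G v \<subseteq> verts G" using simple_graph_edge[OF assms] by (auto simp: nbrs_def)
  show "v \<notin> nbrs G v" using simple_graph_edge(3)[OF assms, of v v] by (auto simp: nbrs_def)
  show "finite (nbrs G v)" using * assms finite_subset by (auto simp: simple_graph_def)
qed

lemma finite_edges:
  assumes "simple_graph G"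
  shows "finite (edges G)"
proof (rule finite_subset)
  show "edges G \<subseteq> Pow (verts G)" using simple_graphE[OF assms] by auto
  show "finite (Pow (verts G))" using assms by (simp add: simple_graph_def)
qed

text \<open>Double counting: each edge inside \<open>W\<close> is visited once from either
  end.\<close>

lemma sum_nbrs_eq_sum_edges:
  fixes g :: "'a set \<Rightarrow> 'b::comm_semiring_1"
  assumes G: "simple_graph G" and W: "finite W"
  shows "(\<Sum>i\<in>W. \<Sum>j\<in>nbrs G i \<inter> W. g {i, j}) = 2 * (\<Sum>e\<in>{e\<in>edges G. e \<subseteq> W}. g e)"
proof -
  let ?P = "SIGMA i:W. nbrs G i \<inter> W" and ?E = "{e\<in>edges G. e \<subseteq> W}"
  have fin: "finite ?P" using W by auto
  have "(\<Sum>i\<in>W. \<Sum>j\<in>nbrs G i \<inter> W. g {i, j}) = (\<Sum>p\<in>?P. g {fst p, snd p})"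
    using W by (subst sum.Sigma) (auto simp: split_def)
  also have "\<dots> = (\<Sum>e\<in>?E. \<Sum>p\<in>{p\<in>?P. {fst p, snd p} = e}. g {fst p, snd p})"
    using finite_edges[OF G] fin by (intro sum.group[symmetric]) (auto simp: nbrs_def)
  also have "\<dots> = (\<Sum>e\<in>?E. 2 * g e)"
  proof (rule sum.cong[OF refl])
    fix e assume e: "e \<in> ?E"
    then have "e \<in> edges G" by simp
    then obtain u v where uv: "u \<noteq> v" "e = {u, v}"
      using simple_graphE[OF G] by metis
    have "{p\<in>?P. {fst p, snd p} = e} = {(u, v), (v, u)}"
    proof
      show "{p\<in>?P. {fst p, snd p} = e} \<subseteq> {(u, v), (v, u)}"
        unfolding uv(2) by (auto simp: doubleton_eq_iff)
      have "{u, v} \<in> edges G" "{v, u} \<in> edges G" "u \<in> W" "v \<in> W"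
        using e uv(2) by (auto simp: insert_commute[of v u])
      then show "{(u, v), (v, u)} \<subseteq> {p\<in>?P. {fst p, snd p} = e}"
        unfolding uv(2) by (auto simp: nbrs_def)
    qed
    then show "(\<Sum>p\<in>{p\<in>?P. {fst p, snd p} = e}. g {fst p, snd p}) = 2 * g e"
      using uv by (simp add: insert_commute[of v u] mult_2)
  qed
  finally show ?thesis by (simp add: sum_distrib_left)
qed

text \<open>Half of the quadratic form of the adjacency matrix at \<open>x\<close>. As a sum over
  edges it lets two graphs on the same vertices be compared edge by edge.\<close>

definition edge_weight :: "'a sgraph \<Rightarrow> ('a \<Rightarrow> real) \<Rightarrow> real" where
  "edge_weight G x = (\<Sum>e\<in>edges G. \<Prod>i\<in>e. x i)"

lemma adjacency_row:
  fixes G :: "nat sgraph"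
  assumes "simple_graph G" "verts G = {..<n}"
  shows "(\<Sum>j<n. (if {i, j} \<in> edges G then 1 else 0) * x j) = (\<Sum>j\<in>nbrs G i. x j :: real)"
proof -
  have "(\<Sum>j<n. (if {i, j} \<in> edges G then 1 else 0) * x j)
      = (\<Sum>j<n. if j \<in> nbrs G i then x j else 0)"
    by (intro sum.cong) (auto simp: nbrs_def)
  also have "\<dots> = (\<Sum>j\<in>{..<n} \<inter> nbrs G i. x j)"
    by (rule sum.inter_restrict[symmetric]) simp
  also have "{..<n} \<inter> nbrs G i = nbrs G i" using nbrs_simple(1)[OF assms(1)] assms(2) by auto
  finally show ?thesis .
qed

lemma edge_weight_eq_sum_nbrs:
  assumes "simple_graph G"
  shows "2 * edge_weight G x = (\<Sum>i\<in>verts G. x i * (\<Sum>j\<in>nbrs G i. x j))"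
proof -
  have "(\<Sum>i\<in>verts G. x i * (\<Sum>j\<in>nbrs G i. x j))
      = (\<Sum>i\<in>verts G. \<Sum>j\<in>nbrs G i \<inter> verts G. \<Prod>p\<in>{i, j}. x p)"
  proof (rule sum.cong[OF refl])
    fix i
    have "nbrs G i \<inter> verts G = nbrs G i" using nbrs_simple(1)[OF assms] by auto
    moreover have "(\<Prod>p\<in>{i, j}. x p) = x i * x j" if "j \<in> nbrs G i" for j
      using that nbrs_simple(2)[OF assms, of i] by (cases "i = j") auto
    ultimately show "x i * (\<Sum>j\<in>nbrs G i. x j) = (\<Sum>j\<in>nbrs G i \<inter> verts G. \<Prod>p\<in>{i, j}. x p)"
      by (simp add: sum_distrib_left)
  qed
  also have "\<dots> = 2 * (\<Sum>e\<in>{e\<in>edges G. e \<subseteq> verts G}. \<Prod>p\<in>e. x p)"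
    using assms by (intro sum_nbrs_eq_sum_edges) (simp_all add: simple_graph_def)
  also have "{e\<in>edges G. e \<subseteq> verts G} = edges G"
    using simple_graphE[OF assms] by auto
  finally show ?thesis by (simp add: edge_weight_def)
qed

lemma quad_form_adjacency:
  fixes G :: "nat sgraph"
  assumes "simple_graph G" "verts G = {..<n}"
  shows "quad_form n (\<lambda>i j. if {i, j} \<in> edges G then 1 else 0) x = 2 * edge_weight G x"
proof -
  have "quad_form n (\<lambda>i j. if {i, j} \<in> edges G then 1 else 0) x
      = (\<Sum>i<n. x i * (\<Sum>j<n. (if {i, j} \<in> edges G then 1 else 0) * x j))"
    unfolding quad_form_def sum_distrib_left by (intro sum.cong) auto
  also have "\<dots> = (\<Sum>i<n. x i * (\<Sum>j\<in>nbrs G i. x j))"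
    by (simp only: adjacency_row[OF assms])
  also have "\<dots> = 2 * edge_weight G x"
    using edge_weight_eq_sum_nbrs[OF assms(1)] assms(2) by simp
  finally show ?thesis .
qed

text \<open>Ties the maximum over matrix eigenvalues to the variational value \<open>\<mu>\<close>:
  this value is itself an eigenvalue, and evaluating the form at an eigenvector shows that no
  eigenvalue exceeds it.\<close>

lemma largest_eigenvalue_perron:
  assumes G: "simple_graph G" "verts G = {..<n}" and n: "0 < n"
  shows "2 * edge_weight G y \<le> largest_eigenvalue n G * (\<Sum>i<n. (y i)^2)" (is ?rayleigh)
    and "\<exists>x. (\<forall>i. 0 \<le> x i) \<and> (\<Sum>i<n. (x i)^2) = 1 \<and>
      (\<forall>i<n. (\<Sum>j\<in>nbrs G i. x j) = largest_eigenvalue n G * x i)" (is ?perron)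
proof -
  let ?a = "\<lambda>i j. if {i, j} \<in> edges G then 1 else (0::real)"
  let ?A = "adjacency_matrix n G"
  obtain x \<mu> where x: "\<And>i. 0 \<le> x i" "(\<Sum>i<n. (x i)^2) = 1"
    "\<And>y. quad_form n ?a y \<le> \<mu> * (\<Sum>i<n. (y i)^2)"
    "\<And>i. i < n \<Longrightarrow> (\<Sum>j<n. ?a i j * x j) = \<mu> * x i"
  proof (rule nonneg_symmetric_perron[of ?a n])
    show "?a i j = ?a j i" for i j by (simp add: insert_commute)
  qed (use n in auto)
  have A: "?A \<in> carrier_mat n n" by (simp add: adjacency_matrix_def)
  have mult: "(?A *\<^sub>v v) $ i = (\<Sum>j<n. ?a i j * v $ j)" if "i < n" "v \<in> carrier_vec n" for v i
    using that by (simp add: adjacency_matrix_def scalar_prod_def atLeast0LessThan)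
  have "eigenvector ?A (vec n x) \<mu>"
  proof -
    have "vec n x \<noteq> 0\<^sub>v n"
    proof
      assume "vec n x = 0\<^sub>v n"
      then have "x i = 0" if "i < n" for i using that by (metis index_vec index_zero_vec(1))
      then show False using x(2) by simp
    qed
    moreover have "?A *\<^sub>v vec n x = \<mu> \<cdot>\<^sub>v vec n x"
      using A x(4) mult[of _ "vec n x"] by (intro eq_vecI) auto
    ultimately show ?thesis using A unfolding eigenvector_def by auto
  qed
  then have "eigenvalue ?A \<mu>" unfolding eigenvalue_def by blast
  moreover have "k \<le> \<mu>" if ev: "eigenvalue ?A k" for k
  proof -
    obtain v where v: "v \<in> carrier_vec n" "v \<noteq> 0\<^sub>v n" "?A *\<^sub>v v = k \<cdot>\<^sub>v v"
      using ev A unfolding eigenvalue_def eigenvector_def by auto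
    have row: "(\<Sum>j<n. ?a i j * v $ j) = k * v $ i" if "i < n" for i
      using mult[OF that v(1)] v that by simp
    have "quad_form n ?a (\<lambda>i. v $ i) = (\<Sum>i<n. v $ i * (\<Sum>j<n. ?a i j * v $ j))"
      unfolding quad_form_def sum_distrib_left by (intro sum.cong) auto
    also have "\<dots> = (\<Sum>i<n. v $ i * (k * v $ i))" by (intro sum.cong) (auto simp only: row lessThan_iff)
    also have "\<dots> = k * (\<Sum>i<n. (v $ i)^2)"
      by (simp add: sum_distrib_left power2_eq_square algebra_simps)
    finally have "k * (\<Sum>i<n. (v $ i)^2) \<le> \<mu> * (\<Sum>i<n. (v $ i)^2)" using x(3)[of "\<lambda>i. v $ i"] by simp
    moreover have "(\<Sum>i<n. (v $ i)^2) > 0"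
    proof -
      obtain i where "i < n" "v $ i \<noteq> 0"
        using v(1,2) by (metis carrier_vecD eq_vecI index_zero_vec)
      then show ?thesis by (intro sum_pos2[of _ i]) auto
    qed
    ultimately show ?thesis by simp
  qed
  \<comment> \<open>\<open>Max\<close> is meaningful only on a finite set; the eigenvalues are roots
    of a nonzero polynomial.\<close>
  moreover have "finite {k. eigenvalue ?A k}"
  proof -
    have "char_poly ?A \<noteq> 0" using degree_monic_char_poly[OF A] n by auto
    then show ?thesis unfolding eigenvalue_root_char_poly[OF A] by (rule poly_roots_finite)
  qed
  ultimately have \<mu>: "largest_eigenvalue n G = \<mu>"
    unfolding largest_eigenvalue_def by (intro Max_eqI) auto
  show ?rayleigh using x(3)[of y] unfolding quad_form_adjacency[OF G] \<mu> .
  show ?perron using x(1,2,4) unfolding adjacency_row[OF G] \<mu> by blast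
qed

text \<open>The equality case of the Rayleigh bound. It serves to exploit ties, when a modified
  graph has at least the same weight at \<open>x\<close>.\<close>

lemma eigenvector_of_edge_weight_maximal:
  assumes G: "simple_graph G" "verts G = {..<n}"
    and le: "largest_eigenvalue n G \<le> \<mu>"
    and max: "\<mu> * (\<Sum>i<n. (x i)^2) \<le> 2 * edge_weight G x"
    and i: "i < n"
  shows "(\<Sum>j\<in>nbrs G i. x j) = \<mu> * x i"
proof -
  let ?a = "\<lambda>i j. if {i, j} \<in> edges G then 1 else (0::real)"
  have "quad_form n ?a y \<le> \<mu> * (\<Sum>i<n. (y i)^2)" for y
  proof -
    have "quad_form n ?a y \<le> largest_eigenvalue n G * (\<Sum>i<n. (y i)^2)"
      unfolding quad_form_adjacency[OF G] using largest_eigenvalue_perron(1)[OF G] i by simp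
    also have "\<dots> \<le> \<mu> * (\<Sum>i<n. (y i)^2)"
      using le by (intro mult_right_mono sum_nonneg) auto
    finally show ?thesis .
  qed
  then have "(\<Sum>j<n. ?a i j * x j) = \<mu> * x i"
  proof (rule eigenvector_of_quad_form_maximal[rotated])
    show "?a i j = ?a j i" for i j by (simp add: insert_commute)
    show "\<mu> * (\<Sum>i<n. (x i)^2) \<le> quad_form n ?a x"
      using max unfolding quad_form_adjacency[OF G] .
  qed (rule i)
  then show ?thesis unfolding adjacency_row[OF G] .
qed

section \<open>Vertices of large weight\<close>

definition common_nbrs :: "'a sgraph \<Rightarrow> 'a set \<Rightarrow> 'a set" where
  "common_nbrs G S = {w \<in> verts G. S \<subseteq> nbrs G w}"

text \<open>What the eigenvector analysis uses: \<open>sparse\<close> is a linear edge bound for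
  every induced subgraph, \<open>few_common\<close> bounds common neighbourhoods of
  \<open>k + 1\<close> vertices, and \<open>lam_sq\<close> is the comparison with the complete
  bipartite graph with parts of size \<open>k\<close> and \<open>n - k\<close>. The maximum of
  \<open>x\<close> is scaled to 1, so a weight close to 1 is close to the largest possible.\<close>

locale sparse_perron_graph =
  fixes G :: "nat sgraph" and n k m :: nat and D lam :: real and x :: "nat \<Rightarrow> real"
  assumes simple: "simple_graph G" and vertsG: "verts G = {..<n}"
    and sparse: "\<And>W. W \<subseteq> {..<n} \<Longrightarrow> (\<Sum>v\<in>W. real (card (nbrs G v \<inter> W))) \<le> D * card W"
    and few_common: "\<And>S. S \<subseteq> {..<n} \<Longrightarrow> card S = Suc k \<Longrightarrow> card (common_nbrs G S) < m"
    and k_pos: "1 \<le> k" and D_ge: "1 \<le> D" and n_ge: "2 * k \<le> n"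
    and x_nonneg: "\<And>i. 0 \<le> x i" and x_le: "\<And>i. i < n \<Longrightarrow> x i \<le> 1"
    and x_max: "\<exists>i<n. x i = 1"
    and eigen: "\<And>i. i < n \<Longrightarrow> (\<Sum>j\<in>nbrs G i. x j) = lam * x i"
    and lam_pos: "0 < lam" and lam_sq: "real k * (real n - real k) \<le> lam^2"
begin

definition large :: "real \<Rightarrow> nat set" where
  "large t = {v. v < n \<and> t \<le> x v}"

lemma large_subset: "large t \<subseteq> {..<n}" by (auto simp: large_def)

lemma finite_large [simp]: "finite (large t)" using large_subset finite_subset by blast

lemma nbrs_subset: "nbrs G v \<subseteq> {..<n}" using nbrs_simple(1)[OF simple] vertsG by simp

lemma finite_nbrs [simp]: "finite (nbrs G v)" using nbrs_simple(3)[OF simple] .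

lemma card_nbrs_le: "card (nbrs G v) \<le> n"
  using card_mono[OF finite_lessThan nbrs_subset, of v] by simp

lemma sum_deg: "(\<Sum>v<n. real (card (nbrs G v))) \<le> D * n"
proof -
  have "nbrs G v \<inter> {..<n} = nbrs G v" for v using nbrs_subset by blast
  then show ?thesis using sparse[of "{..<n}"] by simp
qed

lemma lam_sq_ge: "real n / 2 \<le> lam^2"
proof -
  have "real n / 2 \<le> 1 * (real n - real k)" using n_ge by simp
  also have "\<dots> \<le> real k * (real n - real k)" using k_pos n_ge by (intro mult_right_mono) auto
  finally show ?thesis using lam_sq by linarith
qed

lemma lam_sq_eigen:
  assumes "v < n"
  shows "lam^2 * x v = (\<Sum>w\<in>nbrs G v. \<Sum>u\<in>nbrs G w. x u)"
proof -
  have "lam^2 * x v = lam * (\<Sum>w\<in>nbrs G v. x w)"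
    using eigen[OF assms] by (simp add: power2_eq_square)
  also have "\<dots> = (\<Sum>w\<in>nbrs G v. lam * x w)" by (rule sum_distrib_left)
  also have "\<dots> = (\<Sum>w\<in>nbrs G v. \<Sum>u\<in>nbrs G w. x u)"
    using nbrs_subset[of v] by (intro sum.cong refl eigen[symmetric]) auto
  finally show ?thesis .
qed

text \<open>\<open>lam^2 * x v\<close> adds up the end weights of the walks of length two from
  \<open>v\<close>. Ends of weight below \<open>s\<close> contribute at most \<open>s\<close> times
  the total degree, so only the ends in \<open>large s\<close> need attention.\<close>

lemma lam_sq_le_large:
  fixes s :: real
  assumes v: "v < n" and s: "0 \<le> s"
  shows "lam^2 * x v \<le> s * D * n + (\<Sum>w\<in>nbrs G v. \<Sum>u\<in>nbrs G w \<inter> large s. x u)"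
proof -
  have split: "(\<Sum>u\<in>nbrs G w. x u) \<le> s * card (nbrs G w) + (\<Sum>u\<in>nbrs G w \<inter> large s. x u)" for w
  proof -
    have "(\<Sum>u\<in>nbrs G w. x u) = (\<Sum>u\<in>nbrs G w - large s. x u) + (\<Sum>u\<in>nbrs G w \<inter> large s. x u)"
      by (subst add.commute, rule sum.Int_Diff) simp
    moreover have "(\<Sum>u\<in>nbrs G w - large s. x u) \<le> (\<Sum>u\<in>nbrs G w - large s. s)"
      using nbrs_subset[of w] by (intro sum_mono) (auto simp: large_def)
    moreover have "(\<Sum>u\<in>nbrs G w - large s. s) \<le> s * card (nbrs G w)"
    proof -
      have "card (nbrs G w - large s) \<le> card (nbrs G w)" by (intro card_mono) auto
      then show ?thesis using s by (simp add: mult.commute mult_left_mono)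
    qed
    ultimately show ?thesis by linarith
  qed
  have "(\<Sum>w\<in>nbrs G v. s * card (nbrs G w)) \<le> s * D * n"
  proof -
    have "(\<Sum>w\<in>nbrs G v. real (card (nbrs G w))) \<le> (\<Sum>w<n. real (card (nbrs G w)))"
      using nbrs_subset by (intro sum_mono2) auto
    also have "\<dots> \<le> D * n" by (rule sum_deg)
    finally show ?thesis using s by (simp add: sum_distrib_left[symmetric] mult.assoc mult_left_mono)
  qed
  moreover have "lam^2 * x v \<le>
      (\<Sum>w\<in>nbrs G v. s * card (nbrs G w)) + (\<Sum>w\<in>nbrs G v. \<Sum>u\<in>nbrs G w \<inter> large s. x u)"
    unfolding lam_sq_eigen[OF v] sum.distrib[symmetric] using split by (rule sum_mono)
  ultimately show ?thesis by linarith
qed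

text \<open>A first crude count. As \<open>lam\<close> has order at least sqrt(n), it allows
  O(sqrt(n)) large vertices, which is enough to start the sharper count in
  \<open>card_large\<close>.\<close>

lemma card_large_lam:
  fixes s :: real
  shows "card (large s) * s * lam \<le> D * n"
proof -
  have "card (large s) * s * lam = (\<Sum>v\<in>large s. lam * s)" by simp
  also have "\<dots> \<le> (\<Sum>v\<in>large s. lam * x v)"
    using lam_pos by (intro sum_mono) (auto simp: large_def)
  also have "\<dots> = (\<Sum>v\<in>large s. \<Sum>w\<in>nbrs G v. x w)"
    by (intro sum.cong) (auto simp: large_def eigen)
  also have "\<dots> \<le> (\<Sum>v\<in>large s. real (card (nbrs G v)))"
  proof (intro sum_mono)
    fix v
    have "(\<Sum>w\<in>nbrs G v. x w) \<le> (\<Sum>w\<in>nbrs G v. 1)"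
      using nbrs_subset by (intro sum_mono x_le) auto
    then show "(\<Sum>w\<in>nbrs G v. x w) \<le> real (card (nbrs G v))" by simp
  qed
  also have "\<dots> \<le> (\<Sum>v<n. real (card (nbrs G v)))"
    using large_subset by (intro sum_mono2) auto
  also have "\<dots> \<le> D * n" by (rule sum_deg)
  finally show ?thesis .
qed

text \<open>Sparsity of the graph on the neighbours of \<open>v\<close> together with
  \<open>large s\<close> bounds the walks ending in \<open>large s\<close> by \<open>D\<close> times
  the number of these vertices. The crude count makes \<open>large s\<close> negligible, so a weight
  of at least \<open>t\<close> requires linearly many neighbours.\<close>

lemma degree_large:
  fixes t :: real
  assumes t: "0 < t" and lam: "32 * D^3 / t^2 \<le> lam" and v: "v \<in> large t"
  shows "t * n / (8 * D) \<le> card (nbrs G v)"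
proof -
  \<comment> \<open>Walks with ends of weight below this \<open>s\<close> cost at most
    \<open>t * n / 4\<close>, half of the lower bound \<open>t * n / 2\<close> for
    \<open>lam^2 * x v\<close>.\<close>
  define s where "s = t / (4 * D)"
  have s: "0 < s" "s * D = t / 4" using t D_ge by (auto simp: s_def)
  let ?L = "large s" and ?N = "nbrs G v"
  have vn: "v < n" "t \<le> x v" using v by (auto simp: large_def)
  have L: "D * card ?L \<le> t * n / 8"
  proof -
    have "32 * D^3 / t^2 * (s * card ?L) \<le> lam * (s * card ?L)"
      using lam s(1) by (intro mult_right_mono) auto
    also have "\<dots> \<le> D * n" using card_large_lam[of s] by (simp add: algebra_simps)
    finally have "32 * D^3 / t^2 * (t / (4 * D) * card ?L) \<le> D * n" by (simp add: s_def)
    also have "32 * D^3 / t^2 * (t / (4 * D) * card ?L) = D * (8 * D * card ?L / t)"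
      using t D_ge by (simp add: field_simps power2_eq_square power3_eq_cube)
    finally have "8 * D * card ?L / t \<le> n" using D_ge by (subst (asm) mult_le_cancel_left_pos) auto
    then show ?thesis using t by (simp add: field_simps)
  qed
  have "(\<Sum>w\<in>?N. \<Sum>u\<in>nbrs G w \<inter> ?L. x u) \<le> (\<Sum>w\<in>?N. real (card (nbrs G w \<inter> ?L)))"
  proof (intro sum_mono)
    fix w
    have "(\<Sum>u\<in>nbrs G w \<inter> ?L. x u) \<le> (\<Sum>u\<in>nbrs G w \<inter> ?L. 1)"
      using nbrs_subset by (intro sum_mono x_le) auto
    then show "(\<Sum>u\<in>nbrs G w \<inter> ?L. x u) \<le> real (card (nbrs G w \<inter> ?L))" by simp
  qed
  also have "\<dots> \<le> (\<Sum>w\<in>?N \<union> ?L. real (card (nbrs G w \<inter> (?N \<union> ?L))))"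
  proof -
    have "(\<Sum>w\<in>?N. real (card (nbrs G w \<inter> ?L))) \<le> (\<Sum>w\<in>?N. real (card (nbrs G w \<inter> (?N \<union> ?L))))"
      by (intro sum_mono) (auto intro!: card_mono)
    also have "\<dots> \<le> (\<Sum>w\<in>?N \<union> ?L. real (card (nbrs G w \<inter> (?N \<union> ?L))))"
      by (intro sum_mono2) auto
    finally show ?thesis .
  qed
  also have "\<dots> \<le> D * card (?N \<union> ?L)" using nbrs_subset large_subset by (intro sparse) auto
  also have "\<dots> \<le> D * (card ?N + card ?L)"
    using D_ge card_Un_le[of ?N ?L] by (intro mult_left_mono) auto
  finally have "lam^2 * x v \<le> s * D * n + D * card ?N + D * card ?L"
    using lam_sq_le_large[OF vn(1), of s] s by (simp add: algebra_simps)
  moreover have "real n / 2 * t \<le> lam^2 * x v"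
    using lam_sq_ge vn t by (intro mult_mono) auto
  ultimately have "t * n / 8 \<le> D * card ?N" using L unfolding s(2) by (simp add: algebra_simps)
  then show ?thesis using D_ge by (simp add: field_simps)
qed

text \<open>Large vertices have degree linear in \<open>n\<close>, while all degrees sum to at most
  \<open>D * n\<close>. The resulting bound does not grow with \<open>n\<close>.\<close>

lemma card_large:
  fixes t :: real
  assumes t: "0 < t" and lam: "32 * D^3 / t^2 \<le> lam"
  shows "card (large t) \<le> 8 * D^2 / t"
proof -
  have "card (large t) * (t * n / (8 * D)) = (\<Sum>v\<in>large t. t * n / (8 * D))" by simp
  also have "\<dots> \<le> (\<Sum>v\<in>large t. real (card (nbrs G v)))"
    using degree_large[OF t lam] by (rule sum_mono)
  also have "\<dots> \<le> (\<Sum>v<n. real (card (nbrs G v)))"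
    using large_subset by (intro sum_mono2) auto
  also have "\<dots> \<le> D * n" by (rule sum_deg)
  finally have "real n * (card (large t) * t / (8 * D)) \<le> real n * D" by (simp add: algebra_simps)
  moreover have "0 < real n" using k_pos n_ge by simp
  ultimately have "card (large t) * t / (8 * D) \<le> D" by (simp only: mult_le_cancel_left_pos)
  then show ?thesis using t D_ge by (simp add: field_simps power2_eq_square)
qed

text \<open>A vertex with more than \<open>k\<close> neighbours in \<open>U\<close> is a common
  neighbour of some \<open>k + 1\<close> of them, and each of the at most \<open>2 ^ card U\<close>
  sets of this size has fewer than \<open>m\<close> common neighbours.\<close>

lemma card_exceptional:
  assumes U: "U \<subseteq> {..<n}"
  shows "card {w. w < n \<and> k < card (nbrs G w \<inter> U)} \<le> m * 2 ^ card U"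
proof -
  let ?X = "{S. S \<subseteq> U \<and> card S = Suc k}"
  have finU: "finite U" using U finite_subset by blast
  have finX: "finite ?X" using finU by (auto intro: finite_subset[of _ "Pow U"])
  have "{w. w < n \<and> k < card (nbrs G w \<inter> U)} \<subseteq> (\<Union>S\<in>?X. common_nbrs G S)"
  proof
    fix w assume "w \<in> {w. w < n \<and> k < card (nbrs G w \<inter> U)}"
    then have w: "w < n" "Suc k \<le> card (nbrs G w \<inter> U)" by auto
    obtain S where "S \<subseteq> nbrs G w \<inter> U" "card S = Suc k"
      using obtain_subset_with_card_n[OF w(2)] by blast
    then show "w \<in> (\<Union>S\<in>?X. common_nbrs G S)" using w vertsG by (auto simp: common_nbrs_def)
  qed
  then have "card {w. w < n \<and> k < card (nbrs G w \<inter> U)} \<le> card (\<Union>S\<in>?X. common_nbrs G S)"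
    using finX by (intro card_mono) (auto simp: common_nbrs_def vertsG)
  also have "\<dots> \<le> (\<Sum>S\<in>?X. card (common_nbrs G S))" using finX by (rule card_UN_le)
  also have "\<dots> \<le> (\<Sum>S\<in>?X. m)"
  proof (rule sum_mono)
    fix S assume "S \<in> ?X"
    then have "S \<subseteq> {..<n}" "card S = Suc k" using U by auto
    then show "card (common_nbrs G S) \<le> m" using few_common less_imp_le by blast
  qed
  also have "\<dots> = m * card ?X" by simp
  also have "\<dots> \<le> m * card (Pow U)" using finU by (intro mult_left_mono card_mono) auto
  finally show ?thesis using finU by (simp add: card_Pow)
qed

text \<open>All but boundedly many \<open>w\<close> are typical, that is, have at most \<open>k\<close> neighbours among the
  large vertices and \<open>v\<close>.\<close>

lemma lam_sq_le_degree:
  fixes s b :: real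
  assumes v: "v < n" and s: "0 \<le> s" and M: "card (large s) \<le> M" and b: "0 \<le> b"
    and typical: "\<And>w. w \<in> nbrs G v \<Longrightarrow> card (nbrs G w \<inter> (large s \<union> {v})) \<le> k \<Longrightarrow>
      (\<Sum>u\<in>nbrs G w \<inter> large s. x u) \<le> b"
  shows "lam^2 * x v \<le> s * D * n + m * 2 ^ Suc M * M + card (nbrs G v) * b"
proof -
  let ?U = "large s \<union> {v}"
  let ?X = "{w. w < n \<and> k < card (nbrs G w \<inter> ?U)}"
  have "card ?U \<le> Suc M" using M by (simp add: card_insert_if)
  have "card ?X \<le> m * 2 ^ card ?U" using v large_subset by (intro card_exceptional) auto
  also have "\<dots> \<le> m * 2 ^ Suc M" using \<open>card ?U \<le> Suc M\<close> by (intro mult_left_mono power_increasing) auto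
  finally have X: "card ?X \<le> m * 2 ^ Suc M" .
  have any: "(\<Sum>u\<in>nbrs G w \<inter> large s. x u) \<le> M" for w
  proof -
    have "(\<Sum>u\<in>nbrs G w \<inter> large s. x u) \<le> (\<Sum>u\<in>nbrs G w \<inter> large s. 1)"
      using nbrs_subset by (intro sum_mono x_le) auto
    also have "\<dots> = real (card (nbrs G w \<inter> large s))" by simp
    also have "\<dots> \<le> real (card (large s))" by (intro of_nat_mono card_mono) auto
    finally show ?thesis using M by linarith
  qed
  \<comment> \<open>Every middle vertex is charged \<open>b\<close>, an exceptional one also the
    trivial bound \<open>M\<close>.\<close>
  have "(\<Sum>w\<in>nbrs G v. \<Sum>u\<in>nbrs G w \<inter> large s. x u)
      \<le> (\<Sum>w\<in>nbrs G v. (if w \<in> ?X then real M else 0) + b)"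
  proof (rule sum_mono)
    fix w assume w: "w \<in> nbrs G v"
    then have "w < n" using nbrs_subset by auto
    then show "(\<Sum>u\<in>nbrs G w \<inter> large s. x u) \<le> (if w \<in> ?X then real M else 0) + b"
      using any[of w] b typical[OF w] by (cases "w \<in> ?X") (auto simp: not_less)
  qed
  also have "\<dots> = (\<Sum>w\<in>nbrs G v. if w \<in> ?X then real M else 0) + card (nbrs G v) * b"
    by (simp add: sum.distrib)
  also have "(\<Sum>w\<in>nbrs G v. if w \<in> ?X then real M else 0) = card (nbrs G v \<inter> ?X) * real M"
    by (subst sum.inter_restrict[symmetric]) auto
  also have "card (nbrs G v \<inter> ?X) * real M \<le> (m * 2 ^ Suc M) * real M"
  proof -
    have "card (nbrs G v \<inter> ?X) \<le> card ?X" by (intro card_mono) auto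
    then have "card (nbrs G v \<inter> ?X) \<le> m * 2 ^ Suc M" using X by linarith
    then show ?thesis by (intro mult_right_mono of_nat_mono) auto
  qed
  finally show ?thesis using lam_sq_le_large[OF v s] by simp
qed

text \<open>A typical neighbour \<open>w\<close> of \<open>v\<close> is adjacent to \<open>v\<close>
  itself, which leaves room for at most \<open>k - 1\<close> other large neighbours, each of weight
  at most 1.\<close>

lemma lam_sq_le_degree':
  fixes s :: real
  assumes v: "v < n" and s: "0 \<le> s" and M: "card (large s) \<le> M"
  shows "lam^2 * x v \<le> s * D * n + m * 2 ^ Suc M * M + card (nbrs G v) * (x v + (real k - 1))"
proof (rule lam_sq_le_degree[OF v s M])
  show "0 \<le> x v + (real k - 1)" using x_nonneg[of v] k_pos by simp
  fix w assume w: "w \<in> nbrs G v" "card (nbrs G w \<inter> (large s \<union> {v})) \<le> k"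
  let ?A = "nbrs G w \<inter> large s"
  have vw: "v \<in> nbrs G w" using w(1) by (simp add: nbrs_sym)
  have "?A - {v} \<subseteq> (nbrs G w \<inter> (large s \<union> {v})) - {v}" by auto
  then have "card (?A - {v}) \<le> card ((nbrs G w \<inter> (large s \<union> {v})) - {v})"
    by (intro card_mono) auto
  also have "\<dots> \<le> k - 1" using w(2) vw by (subst card_Diff_singleton) auto
  finally have card: "card (?A - {v}) \<le> k - 1" .
  have "(\<Sum>u\<in>?A. x u) \<le> (\<Sum>u\<in>insert v (?A - {v}). x u)"
    using x_nonneg by (intro sum_mono2) auto
  also have "\<dots> = x v + (\<Sum>u\<in>?A - {v}. x u)" by (subst sum.insert) auto
  also have "(\<Sum>u\<in>?A - {v}. x u) \<le> (\<Sum>u\<in>?A - {v}. 1)"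
    using nbrs_subset by (intro sum_mono x_le) auto
  also have "\<dots> \<le> real k - 1" using card k_pos by simp
  finally show "(\<Sum>u\<in>?A. x u) \<le> x v + (real k - 1)" by simp
qed

lemma sum_le_card_all_large:
  fixes d :: real
  assumes A: "finite A" "card A \<le> k" "A \<subseteq> {..<n}" and sum: "real k - d < (\<Sum>u\<in>A. x u)" and d: "d \<le> 1"
  shows "card A = k" "\<And>u. u \<in> A \<Longrightarrow> 1 - d < x u"
proof -
  have le: "(\<Sum>u\<in>B. x u) \<le> card B" if "B \<subseteq> A" for B
  proof -
    have "(\<Sum>u\<in>B. x u) \<le> (\<Sum>u\<in>B. 1)" using that A by (intro sum_mono x_le) auto
    then show ?thesis by simp
  qed
  have "real k - 1 < card A" using le[of A] sum d by simp
  then show cA: "card A = k" using A(2) by linarith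
  fix u assume u: "u \<in> A"
  then have "(\<Sum>u\<in>A. x u) = x u + (\<Sum>u\<in>A - {u}. x u)" using A by (intro sum.remove) auto
  also have "\<dots> \<le> x u + (real k - 1)"
  proof -
    have "card (A - {u}) = k - 1" using u cA A(1) by simp
    then show ?thesis using le[of "A - {u}"] k_pos by auto
  qed
  finally show "1 - d < x u" using sum by linarith
qed

text \<open>\<open>L\<close> consists of the large neighbours of a suitable typical neighbour
  \<open>w\<close> of a vertex of weight 1. Being \<open>k\<close> numbers of at most 1 with sum
  above \<open>k - d\<close>, the weights on \<open>L\<close> all exceed \<open>1 - d\<close>. The
  two-walk bound then forces every degree in \<open>L\<close> to be at least
  \<open>(1 - 2 * d) * n\<close>, so almost all vertices are adjacent to all of \<open>L\<close>.
  Any other vertex shares few neighbours with \<open>L\<close>, hence has small degree and small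
  weight.\<close>

lemma dominant_set:
  fixes e d s :: real and M :: nat
  defines "d \<equiv> e / (6 * k^2)"
  defines "s \<equiv> d / (2 * D)"
  defines "M \<equiv> nat \<lfloor>8 * D^2 / s\<rfloor>"
  assumes e: "0 < e" "e \<le> 1"
    and lam: "32 * D^3 / s^2 \<le> lam"
    and n: "m * 2 ^ Suc M * M + real k^2 + k * m < d * n / 2"
  obtains L where "L \<subseteq> {..<n}" "card L = k" "\<And>v. v \<in> L \<Longrightarrow> 1 - e \<le> x v"
    "card ({..<n} - common_nbrs G L) \<le> e * n" "\<And>v. v < n \<Longrightarrow> v \<notin> L \<Longrightarrow> x v \<le> e"
proof -
  define E where "E = real (m * 2 ^ Suc M * M)"
  have k: "1 \<le> real k" "1 \<le> (real k)^2" "real k \<le> (real k)^2"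
    using k_pos by (auto simp: power2_eq_square mult_ge1_I)
  have d0: "0 < d" using e k_pos by (simp add: d_def)
  \<comment> \<open>The estimate outside \<open>L\<close> ends with
    \<open>x u \<le> 6 * d * k^2\<close>; this is where the factor in \<open>d\<close> comes
    from.\<close>
  have de: "d * (6 * k^2) = e" using k_pos by (simp add: d_def)
  have d1: "d \<le> 1"
  proof -
    have "d * 1 \<le> d * (6 * (real k)^2)" using d0 k(2) by (intro mult_left_mono) linarith+
    then show ?thesis using de e by simp
  qed
  have s: "0 < s" "s * D = d / 2" using d0 D_ge by (auto simp: s_def)
  have M: "card (large s) \<le> M"
    using card_large[OF s(1) lam] unfolding M_def by (simp add: le_nat_floor)
  have E: "E + real k^2 + k * m < d * n / 2" using n unfolding E_def by simp
  have E0: "E \<ge> 0" unfolding E_def by simp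
  have lam_sq': "real k * n - (real k)^2 \<le> lam^2"
    using lam_sq by (simp add: algebra_simps power2_eq_square)
  have star: "lam^2 * x v \<le> d / 2 * n + E + card (nbrs G v) * (x v + (real k - 1))" if "v < n" for v
    using lam_sq_le_degree'[OF that _ M] s unfolding E_def by simp
  obtain v where v: "v < n" "x v = 1" using x_max by blast
  \<comment> \<open>If every typical neighbour saw weight at most \<open>k - d\<close> among the
    large vertices, then \<open>lam^2\<close> would be at most \<open>(k - d / 2) * n + E\<close>,
    which is below \<open>k * n - k^2\<close>.\<close>
  have "\<exists>w\<in>nbrs G v. card (nbrs G w \<inter> (large s \<union> {v})) \<le> k \<and>
      real k - d < (\<Sum>u\<in>nbrs G w \<inter> large s. x u)"
  proof (rule ccontr)
    assume "\<not> ?thesis"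
    then have "lam^2 * x v \<le> s * D * n + m * 2 ^ Suc M * M + card (nbrs G v) * (real k - d)"
      using s d1 k by (intro lam_sq_le_degree[OF v(1) _ M]) (auto simp: not_less)
    also have "card (nbrs G v) * (real k - d) \<le> n * (real k - d)"
      using card_nbrs_le[of v] d1 k by (intro mult_right_mono) auto
    finally have "lam^2 \<le> d / 2 * n + E + n * (real k - d)" using v s unfolding E_def by simp
    with lam_sq' have "d * n / 2 \<le> E + (real k)^2" by (simp add: algebra_simps)
    moreover have "0 \<le> real k * m" by simp
    ultimately show False using E by linarith
  qed
  then obtain w where w: "w \<in> nbrs G v" "card (nbrs G w \<inter> (large s \<union> {v})) \<le> k"
    "real k - d < (\<Sum>u\<in>nbrs G w \<inter> large s. x u)" by blast
  define L where "L = nbrs G w \<inter> large s"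
  have L_sub: "L \<subseteq> {..<n}" "finite L" using nbrs_subset by (auto simp: L_def)
  have "card L \<le> card (nbrs G w \<inter> (large s \<union> {v}))" unfolding L_def by (intro card_mono) auto
  then have "card L \<le> k" using w(2) by linarith
  from sum_le_card_all_large[OF L_sub(2) this L_sub(1) w(3)[folded L_def] d1]
  have cL: "card L = k" and xL: "\<And>u. u \<in> L \<Longrightarrow> 1 - d < x u" by auto
  have dL: "(1 - 2 * d) * n \<le> card (nbrs G u)" if u: "u \<in> L" for u
  proof -
    have un: "u < n" using u L_sub by auto
    have "(1 - d) * (real k * n - (real k)^2) \<le> x u * lam^2"
      using xL[OF u] lam_sq' d1 k n_ge x_nonneg
      by (intro mult_mono) (auto simp: power2_eq_square)
    also have "\<dots> \<le> d / 2 * n + E + card (nbrs G u) * (x u + (real k - 1))"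
      using star[OF un] by (simp add: mult.commute)
    also have "card (nbrs G u) * (x u + (real k - 1)) \<le> card (nbrs G u) * real k"
      using x_le[OF un] by (intro mult_left_mono) auto
    finally have 1: "(1 - d) * (real k * n) - (1 - d) * (real k)^2 \<le> d * n / 2 + E + card (nbrs G u) * real k"
      by (simp add: algebra_simps)
    have 2: "(1 - d) * (real k)^2 \<le> (real k)^2" using d0 d1 by (intro mult_left_le_one_le) auto
    have 3: "d * n * 1 \<le> d * n * real k" using d0 k by (intro mult_left_mono) auto
    have 4: "0 \<le> real k * m" by simp
    have "(1 - d) * (real k * n) - d * n * k \<le> card (nbrs G u) * real k"
      using 1 2 3 4 E by linarith
    then have "((1 - 2 * d) * n) * real k \<le> card (nbrs G u) * real k"
      by (simp add: algebra_simps)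
    then show ?thesis using k by (simp add: mult_le_cancel_right)
  qed
  have cn: "card ({..<n} - common_nbrs G L) \<le> 2 * d * k * n"
  proof -
    have "{..<n} - common_nbrs G L \<subseteq> (\<Union>u\<in>L. {..<n} - nbrs G u)"
      using vertsG by (auto simp: common_nbrs_def nbrs_sym)
    then have "card ({..<n} - common_nbrs G L) \<le> card (\<Union>u\<in>L. {..<n} - nbrs G u)"
      using L_sub by (intro card_mono) auto
    also have "\<dots> \<le> (\<Sum>u\<in>L. card ({..<n} - nbrs G u))" using L_sub(2) by (rule card_UN_le)
    finally have "real (card ({..<n} - common_nbrs G L)) \<le> (\<Sum>u\<in>L. real (card ({..<n} - nbrs G u)))"
      by (metis of_nat_mono of_nat_sum)
    also have "\<dots> \<le> (\<Sum>u\<in>L. 2 * d * n)"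
    proof (rule sum_mono)
      fix u assume "u \<in> L"
      have "card ({..<n} - nbrs G u) = n - card (nbrs G u)"
        using nbrs_subset[of u] by (simp add: card_Diff_subset)
      then have "real (card ({..<n} - nbrs G u)) = real n - card (nbrs G u)"
        using card_nbrs_le[of u] by simp
      then show "real (card ({..<n} - nbrs G u)) \<le> 2 * d * n"
        using dL[OF \<open>u \<in> L\<close>] by (simp add: algebra_simps)
    qed
    finally show ?thesis using cL by (simp add: algebra_simps)
  qed
  have small: "x u \<le> e" if u: "u < n" "u \<notin> L" for u
  proof -
    \<comment> \<open>\<open>insert u L\<close> has \<open>k + 1\<close> vertices, so
      \<open>u\<close> has fewer than \<open>m\<close> neighbours among the common neighbours of
      \<open>L\<close>; its other neighbours lie in the small defect set.\<close>
    have "nbrs G u \<inter> common_nbrs G L \<subseteq> common_nbrs G (insert u L)"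
      by (auto simp: common_nbrs_def nbrs_sym)
    then have "card (nbrs G u \<inter> common_nbrs G L) \<le> card (common_nbrs G (insert u L))"
      by (intro card_mono) (auto simp: common_nbrs_def vertsG)
    also have "\<dots> < m" using u L_sub cL by (intro few_common) auto
    finally have "card (nbrs G u \<inter> common_nbrs G L) < m" .
    moreover have "card (nbrs G u) \<le> card (nbrs G u \<inter> common_nbrs G L) + card ({..<n} - common_nbrs G L)"
      using nbrs_subset[of u] by (intro order.trans[OF card_mono card_Un_le]) auto
    ultimately have "real (card (nbrs G u)) \<le> real m + real (card ({..<n} - common_nbrs G L))" by linarith
    then have deg: "real (card (nbrs G u)) \<le> m + 2 * d * k * n" using cn by linarith
    have "real n / 2 * x u \<le> lam^2 * x u" using lam_sq_ge x_nonneg by (intro mult_right_mono) auto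
    also have "\<dots> \<le> d / 2 * n + E + card (nbrs G u) * (x u + (real k - 1))" by (rule star[OF u(1)])
    also have "card (nbrs G u) * (x u + (real k - 1)) \<le> (m + 2 * d * k * n) * real k"
      using x_le[OF u(1)] x_nonneg[of u] k d0 deg by (intro mult_mono) auto
    finally have "real n / 2 * x u \<le> d * n / 2 + E + k * m + 2 * d * (real k)^2 * n"
      by (simp add: algebra_simps power2_eq_square)
    also have "\<dots> \<le> d * n + 2 * d * (real k)^2 * n" using E k(2) by linarith
    also have "\<dots> \<le> d * (real k)^2 * n + 2 * d * (real k)^2 * n"
    proof -
      have "d * n * 1 \<le> d * n * (real k)^2" using k(2) d0 by (intro mult_left_mono) auto
      then show ?thesis by (simp add: algebra_simps)
    qed
    also have "\<dots> = real n / 2 * e" using de by (simp add: algebra_simps)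
    finally have "real n / 2 * x u \<le> real n / 2 * e" .
    then show ?thesis using k_pos n_ge by (subst (asm) mult_le_cancel_left_pos) auto
  qed
  show ?thesis
  proof (rule that[OF L_sub(1) cL _ _ small])
    have "d * 1 \<le> d * (6 * (real k)^2)" using d0 k(2) by (intro mult_left_mono) linarith+
    then have "d \<le> e" using de by simp
    then show "1 - e \<le> x u" if "u \<in> L" for u using xL[OF that] by simp
    have "d * (2 * real k) \<le> d * (6 * (real k)^2)"
      using d0 k(2,3) by (intro mult_left_mono) linarith+
    then have "2 * d * k \<le> e" using de by simp
    then have "2 * d * k * n \<le> e * n" by (intro mult_right_mono) auto
    then show "card ({..<n} - common_nbrs G L) \<le> e * n" using cn by linarith
  qed
qed

end

section \<open>Copies of graphs and joins\<close>

lemma simple_graph_finite: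
  assumes "simple_graph G"
  shows "finite (verts G)" "e \<in> edges G \<Longrightarrow> e \<subseteq> verts G"
  using assms simple_graphE[OF assms, of e] by (auto simp: simple_graph_def)

lemma contains_subgraphI:
  assumes "inj_on f (verts F)" "f ` verts F \<subseteq> verts G" "\<And>e. e \<in> edges F \<Longrightarrow> f ` e \<in> edges G"
  shows "contains_subgraph G F"
  using assms unfolding contains_subgraph_def by blast

lemma contains_subgraphE:
  assumes "contains_subgraph G F"
  obtains f where "inj_on f (verts F)" "f ` verts F \<subseteq> verts G" "\<forall>e\<in>edges F. f ` e \<in> edges G"
  using assms unfolding contains_subgraph_def by blast

lemma contains_subgraph_trans:
  assumes "contains_subgraph G F" "contains_subgraph F F'"
  shows "contains_subgraph G F'"
proof -
  obtain f where f: "inj_on f (verts F)" "f ` verts F \<subseteq> verts G" "\<forall>e\<in>edges F. f ` e \<in> edges G"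
    using assms(1) by (rule contains_subgraphE)
  obtain g where g: "inj_on g (verts F')" "g ` verts F' \<subseteq> verts F"
    "\<forall>e\<in>edges F'. g ` e \<in> edges F"
    using assms(2) by (rule contains_subgraphE)
  show ?thesis
  proof (rule contains_subgraphI[of "f \<circ> g"])
    show "inj_on (f \<circ> g) (verts F')" using f(1) g(1,2) by (meson comp_inj_on inj_on_subset)
    show "(f \<circ> g) ` verts F' \<subseteq> verts G" using f(2) g(2) by auto
    show "(f \<circ> g) ` e \<in> edges G" if "e \<in> edges F'" for e
      using f(3) g(3) that by (metis image_comp)
  qed
qed

section \<open>Relabelled and induced graphs\<close>

definition map_graph :: "('a \<Rightarrow> 'b) \<Rightarrow> 'a sgraph \<Rightarrow> 'b sgraph" where
  "map_graph f G = \<lparr>verts = f ` verts G, edges = (`) f ` edges G\<rparr>"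

lemma map_graph_simps [simp]:
  "verts (map_graph f G) = f ` verts G" "edges (map_graph f G) = (`) f ` edges G"
  by (simp_all add: map_graph_def)

lemma induced_subgraph_simps [simp]:
  "verts (induced_subgraph G W) = W" "edges (induced_subgraph G W) = {e \<in> edges G. e \<subseteq> W}"
  by (simp_all add: induced_subgraph_def)

lemma simple_map_graph:
  assumes G: "simple_graph G" and f: "inj_on f (verts G)"
  shows "simple_graph (map_graph f G)"
  unfolding simple_graph_def
proof (intro conjI ballI)
  show "finite (verts (map_graph f G))" using G by (simp add: simple_graph_def)
  fix e assume "e \<in> edges (map_graph f G)"
  then obtain e' where e': "e' \<in> edges G" "e = f ` e'" by auto
  obtain u v where uv: "u \<in> verts G" "v \<in> verts G" "u \<noteq> v" "e' = {u, v}"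
    using G e'(1) by (rule simple_graphE)
  then have "f u \<noteq> f v" using f by (auto dest: inj_onD)
  moreover have "e = {f u, f v}" using e'(2) uv(4) by simp
  ultimately show "\<exists>u\<in>verts (map_graph f G). \<exists>v\<in>verts (map_graph f G). u \<noteq> v \<and> e = {u, v}"
    using uv(1,2) by auto
qed

lemma card_edges_map_graph:
  assumes "simple_graph G" "inj_on f (verts G)"
  shows "card (edges (map_graph f G)) = card (edges G)"
proof -
  have "\<Union>(edges G) \<subseteq> verts G" using simple_graph_finite(2)[OF assms(1)] by blast
  then have "inj_on f (\<Union>(edges G))" using assms(2) inj_on_subset by blast
  then show ?thesis by (simp add: card_image inj_on_image)
qed

lemma map_graph_contained:
  assumes G: "simple_graph G" and f: "inj_on f (verts G)"
  shows "contains_subgraph G (map_graph f G)"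
proof (rule contains_subgraphI[of "inv_into (verts G) f"])
  show "inj_on (inv_into (verts G) f) (verts (map_graph f G))" by (simp add: inj_on_inv_into)
  show "inv_into (verts G) f ` verts (map_graph f G) \<subseteq> verts G"
    by (auto simp: inv_into_into)
  fix e assume "e \<in> edges (map_graph f G)"
  then obtain e' where e': "e' \<in> edges G" "e = f ` e'" by auto
  then have "inv_into (verts G) f ` e = e'"
    using inv_into_image_cancel[OF f] simple_graph_finite(2)[OF G] by auto
  then show "inv_into (verts G) f ` e \<in> edges G" using e' by simp
qed

lemma simple_induced:
  assumes "simple_graph G" "W \<subseteq> verts G"
  shows "simple_graph (induced_subgraph G W)"
  unfolding simple_graph_def
proof (intro conjI ballI)
  show "finite (verts (induced_subgraph G W))"
    using simple_graph_finite(1)[OF assms(1)] assms(2) finite_subset by auto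
  fix e assume "e \<in> edges (induced_subgraph G W)"
  then have e: "e \<in> edges G" "e \<subseteq> W" by auto
  obtain u v where "u \<noteq> v" "e = {u, v}" using assms(1) e(1) by (rule simple_graphE)
  then show "\<exists>u\<in>verts (induced_subgraph G W). \<exists>v\<in>verts (induced_subgraph G W). u \<noteq> v \<and> e = {u, v}"
    using e(2) by auto
qed

lemma contains_induced_subgraph:
  assumes "W \<subseteq> verts G"
  shows "contains_subgraph G (induced_subgraph G W)"
  by (rule contains_subgraphI[of id]) (use assms in auto)

lemma card_edges_le:
  assumes "simple_graph G"
  shows "card (edges G) \<le> (card (verts G))^2"
proof -
  have "edges G \<subseteq> (\<lambda>(u, v). {u, v}) ` (verts G \<times> verts G)"
  proof
    fix e assume "e \<in> edges G"
    with assms obtain u v where "u \<in> verts G" "v \<in> verts G" "e = {u, v}" by (rule simple_graphE)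
    then show "e \<in> (\<lambda>(u, v). {u, v}) ` (verts G \<times> verts G)" by auto
  qed
  then have "card (edges G) \<le> card (verts G \<times> verts G)"
    using simple_graph_finite(1)[OF assms] by (intro surj_card_le) auto
  then show ?thesis by (simp add: card_cartesian_product power2_eq_square)
qed

section \<open>Free graphs and their linear edge bound\<close>

lemma finite_free_graphs: "finite (free_graphs n \<F>)"
proof (rule finite_subset)
  show "free_graphs n \<F> \<subseteq> (\<lambda>E. \<lparr>verts = {..<n}, edges = E\<rparr>) ` Pow (Pow {..<n})"
  proof
    fix G assume "G \<in> free_graphs n \<F>"
    then have G: "simple_graph G" "verts G = {..<n}" by (auto simp: free_graphs_def)
    then have "edges G \<in> Pow (Pow {..<n})" using simple_graph_finite(2)[OF G(1)] by auto
    moreover have "G = \<lparr>verts = {..<n}, edges = edges G\<rparr>" using G(2) by (cases G) simp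
    ultimately show "G \<in> (\<lambda>E. \<lparr>verts = {..<n}, edges = E\<rparr>) ` Pow (Pow {..<n})" by blast
  qed
qed simp

text \<open>The asymptotic bound holds only from some \<open>N\<close> on; below \<open>N\<close>
  the trivial bound \<open>n^2 \<le> N * n\<close> takes over. A constant valid for every order is
  needed because the bound is applied to induced subgraphs of every size.\<close>

lemma free_graphs_linear:
  assumes "(\<lambda>n. real (ex n \<F>)) \<in> O(\<lambda>n. real n)"
  shows "\<exists>C::real. 1 \<le> C \<and> (\<forall>n. \<forall>G\<in>free_graphs n \<F>. real (card (edges G)) \<le> C * n)"
proof -
  obtain c where c: "\<forall>\<^sub>F n in sequentially. norm (real (ex n \<F>)) \<le> c * norm (real n)"
    using assms by (elim landau_o.bigE)
  then obtain N where N: "\<And>n. N \<le> n \<Longrightarrow> real (ex n \<F>) \<le> c * real n"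
    unfolding eventually_sequentially by auto
  define C where "C = max 1 (max c (real N))"
  have "real (card (edges G)) \<le> C * n" if G: "G \<in> free_graphs n \<F>" for n and G
  proof (cases "N \<le> n")
    case True
    have "card (edges G) \<le> ex n \<F>"
      unfolding ex_def using G finite_free_graphs by (intro Max_ge) auto
    then have "real (card (edges G)) \<le> c * n" using N[OF True] by linarith
    also have "\<dots> \<le> C * n" by (intro mult_right_mono) (auto simp: C_def)
    finally show ?thesis .
  next
    case False
    have "card (edges G) \<le> n^2" using card_edges_le[of G] G by (auto simp: free_graphs_def)
    then have "real (card (edges G)) \<le> real n * n"
      by (metis of_nat_mono of_nat_mult power2_eq_square)
    also have "\<dots> \<le> C * n" using False by (intro mult_right_mono) (auto simp: C_def)
    finally show ?thesis .
  qed
  moreover have "1 \<le> C" by (simp add: C_def)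
  ultimately show ?thesis by blast
qed

lemma free_graphs_map:
  assumes G: "simple_graph G" "\<forall>F\<in>\<F>. \<not> contains_subgraph G F" and f: "bij_betw f (verts G) {..<n}"
  shows "map_graph f G \<in> free_graphs n \<F>"
proof -
  have inj: "inj_on f (verts G)" and im: "f ` verts G = {..<n}" using f by (auto simp: bij_betw_def)
  then show ?thesis
    using simple_map_graph[OF G(1) inj] contains_subgraph_trans[OF map_graph_contained[OF G(1) inj]] G(2)
    by (auto simp: free_graphs_def)
qed

text \<open>The graph induced on \<open>W\<close>, relabelled to an initial segment of the naturals,
  is free again, so the edge bound applies to it. The factor 2 appears because degrees count each
  edge twice.\<close>

lemma free_graphs_sparse:
  fixes C :: real
  assumes lin: "\<forall>n. \<forall>G\<in>free_graphs n \<F>. real (card (edges G)) \<le> C * n"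
    and G: "G \<in> free_graphs n \<F>" and W: "W \<subseteq> {..<n}"
  shows "(\<Sum>v\<in>W. real (card (nbrs G v \<inter> W))) \<le> 2 * C * card W"
proof -
  have sG: "simple_graph G" "W \<subseteq> verts G" and free: "\<forall>F\<in>\<F>. \<not> contains_subgraph G F"
    using G W by (auto simp: free_graphs_def)
  have finW: "finite W" using W finite_subset by blast
  let ?I = "induced_subgraph G W"
  have sI: "simple_graph ?I" using simple_induced[OF sG] .
  obtain f where f: "bij_betw f W {..<card W}"
    using ex_bij_betw_finite_nat[OF finW] by (auto simp: atLeast0LessThan)
  have "\<forall>F\<in>\<F>. \<not> contains_subgraph ?I F"
    using contains_subgraph_trans[OF contains_induced_subgraph[OF sG(2)]] free by blast
  then have "map_graph f ?I \<in> free_graphs (card W) \<F>" using free_graphs_map[OF sI] f by simp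
  then have "real (card (edges (map_graph f ?I))) \<le> C * card W" using lin by blast
  moreover have "card (edges (map_graph f ?I)) = card (edges ?I)"
    using f by (intro card_edges_map_graph[OF sI]) (simp add: bij_betw_def)
  moreover have "(\<Sum>v\<in>W. real (card (nbrs G v \<inter> W))) = 2 * real (card (edges ?I))"
    using sum_nbrs_eq_sum_edges[OF sG(1) finW, of "\<lambda>_. 1 :: real"] by simp
  ultimately show ?thesis by simp
qed

text \<open>An independent covering and its complement form a bipartition. The covering is sent to
  \<open>S\<close> and the complement into the common neighbours of \<open>S\<close>, so all
  required edges are present.\<close>

lemma contains_of_common_nbrs:
  assumes F: "simple_graph F" "covering F S\<^sub>0" "independent_set F S\<^sub>0"
    and G: "simple_graph G" and S: "S \<subseteq> verts G" "card S = card S\<^sub>0"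
    and large: "card (verts F) \<le> card (common_nbrs G S)"
  shows "contains_subgraph G F"
proof -
  have fin: "finite (verts F)" "finite S\<^sub>0" "finite S" "finite (common_nbrs G S)"
    using simple_graph_finite(1)[OF F(1)] simple_graph_finite(1)[OF G] F(2) S(1)
    by (auto simp: covering_def common_nbrs_def intro: finite_subset)
  obtain f where f: "bij_betw f S\<^sub>0 S" using fin S(2) by (metis finite_same_card_bij)
  have "card (verts F - S\<^sub>0) \<le> card (common_nbrs G S)"
    using large card_mono[OF fin(1), of "verts F - S\<^sub>0"] by simp
  then obtain g where g: "inj_on g (verts F - S\<^sub>0)" "g ` (verts F - S\<^sub>0) \<subseteq> common_nbrs G S"
    using fin by (metis card_le_inj finite_Diff)
  have disj: "S \<inter> common_nbrs G S = {}"
    using nbrs_simple(2)[OF G] by (auto simp: common_nbrs_def)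
  define h where "h = (\<lambda>p. if p \<in> S\<^sub>0 then f p else g p)"
  have "inj_on h S\<^sub>0 \<longleftrightarrow> inj_on f S\<^sub>0" "inj_on h (verts F - S\<^sub>0) \<longleftrightarrow> inj_on g (verts F - S\<^sub>0)"
    by (rule inj_on_cong; simp add: h_def)+
  then have h: "inj_on h S\<^sub>0" "inj_on h (verts F - S\<^sub>0)" "h ` S\<^sub>0 = S"
    "h ` (verts F - S\<^sub>0) \<subseteq> common_nbrs G S"
    using f g by (auto simp: h_def bij_betw_def)
  show ?thesis
  proof (rule contains_subgraphI[of h])
    have S0: "S\<^sub>0 \<subseteq> verts F" using F(2) by (simp add: covering_def)
    have "inj_on h (S\<^sub>0 \<union> (verts F - S\<^sub>0))" using h disj by (subst inj_on_Un) blast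
    then show "inj_on h (verts F)" using S0 by (simp add: Un_absorb1)
    have "common_nbrs G S \<subseteq> verts G" by (auto simp: common_nbrs_def)
    then show "h ` verts F \<subseteq> verts G" using h(3,4) S(1) by blast
    fix e assume e: "e \<in> edges F"
    then obtain u v where uv: "u \<in> S\<^sub>0" "v \<in> verts F - S\<^sub>0" "e = {u, v}"
    proof -
      obtain a b where ab: "a \<in> verts F" "b \<in> verts F" "e = {a, b}"
        using F(1) e by (rule simple_graphE)
      have "e \<inter> S\<^sub>0 \<noteq> {}" "\<not> e \<subseteq> S\<^sub>0"
        using F(2,3) e by (auto simp: covering_def independent_set_def)
      then show thesis using that[of a b] that[of b a] ab by (auto simp: insert_commute)
    qed
    have "h u \<in> S" "h v \<in> common_nbrs G S"
      using uv(1,2) h(3,4) by auto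
    then have "h u \<in> nbrs G (h v)" by (auto simp: common_nbrs_def)
    then show "h ` e \<in> edges G" using uv(3) by (simp add: nbrs_def insert_commute)
  qed
qed

text \<open>For a graph on \<open>k\<close> vertices this is freeness with respect to \<^const>\<open>H_family\<close>, uniformly in
  the two cases of its definition; see \<open>H_family_free_iff\<close>.\<close>

definition core_free :: "'a sgraph set \<Rightarrow> nat \<Rightarrow> 'b sgraph \<Rightarrow> bool" where
  "core_free \<F> k T \<longleftrightarrow>
     (\<forall>F\<in>\<F>. \<forall>S. covering F S \<longrightarrow> card S \<le> k \<longrightarrow> \<not> contains_subgraph T (induced_subgraph F S))"

lemma core_free_contains:
  assumes "core_free \<F> k T" "contains_subgraph T T'"
  shows "core_free \<F> k T'"
  using assms contains_subgraph_trans unfolding core_free_def by blast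

text \<open>Given a copy of \<open>F\<close>, the vertices sent into \<open>L\<close> form a
  covering of \<open>F\<close>, since every edge of \<open>G\<close> meets \<open>L\<close>. It has
  at most \<open>k\<close> elements, and the copy restricts to the graph it induces.\<close>

lemma free_of_core_free:
  assumes F: "F \<in> \<F>" "simple_graph F" and G: "simple_graph G" and L: "L \<subseteq> verts G" "card L = k"
    and meets: "\<And>e. e \<in> edges G \<Longrightarrow> e \<inter> L \<noteq> {}" and core: "core_free \<F> k (induced_subgraph G L)"
  shows "\<not> contains_subgraph G F"
proof
  assume "contains_subgraph G F"
  then obtain f where f: "inj_on f (verts F)" "f ` verts F \<subseteq> verts G"
    "\<forall>e\<in>edges F. f ` e \<in> edges G" by (rule contains_subgraphE)
  define S where "S = {p \<in> verts F. f p \<in> L}"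
  have "covering F S"
    unfolding covering_def
  proof (intro conjI ballI)
    fix e assume e: "e \<in> edges F"
    then obtain p where "p \<in> e" "f p \<in> L" using meets f(3) e by fastforce
    then show "e \<inter> S \<noteq> {}" using simple_graph_finite(2)[OF F(2) e] by (auto simp: S_def)
  qed (auto simp: S_def)
  moreover have "card S \<le> k"
  proof -
    have "finite L" using L(1) simple_graph_finite(1)[OF G] finite_subset by blast
    moreover have "inj_on f S" "f ` S \<subseteq> L" using f(1) by (auto simp: S_def inj_on_def)
    ultimately show ?thesis using card_inj_on_le L(2) by blast
  qed
  moreover have "contains_subgraph (induced_subgraph G L) (induced_subgraph F S)"
  proof (rule contains_subgraphI[of f])
    show "inj_on f (verts (induced_subgraph F S))" using f(1) by (auto simp: S_def inj_on_def)
    show "f ` verts (induced_subgraph F S) \<subseteq> verts (induced_subgraph G L)" by (auto simp: S_def)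
    show "f ` e \<in> edges (induced_subgraph G L)" if "e \<in> edges (induced_subgraph F S)" for e
      using that f(3) by (auto simp: S_def)
  qed
  ultimately show False using core F(1) unfolding core_free_def by blast
qed

text \<open>A copy of \<open>F[S]\<close> inside \<open>L\<close> would extend to all of
  \<open>F\<close>: the complement of a covering is independent, and any distinct vertices outside
  \<open>L\<close> can take its place because they are joined to all of \<open>L\<close>.\<close>

lemma core_free_of_free:
  assumes F: "\<And>F. F \<in> \<F> \<Longrightarrow> simple_graph F" and G: "simple_graph G"
    and free: "\<And>F. F \<in> \<F> \<Longrightarrow> \<not> contains_subgraph G F"
    and L: "L \<subseteq> verts G"
    and joined: "\<And>u v. u \<in> L \<Longrightarrow> v \<in> verts G - L \<Longrightarrow> {u, v} \<in> edges G"
    and large: "\<And>F. F \<in> \<F> \<Longrightarrow> card (verts F) \<le> card (verts G - L)"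
  shows "core_free \<F> k (induced_subgraph G L)"
  unfolding core_free_def
proof (intro ballI allI impI notI)
  fix F S assume FF: "F \<in> \<F>" and S: "covering F S"
    and "contains_subgraph (induced_subgraph G L) (induced_subgraph F S)"
  then obtain f where f: "inj_on f S" "f ` S \<subseteq> L"
    "\<And>e. e \<in> edges F \<Longrightarrow> e \<subseteq> S \<Longrightarrow> f ` e \<in> edges G"
    by (auto elim!: contains_subgraphE)
  have finF: "finite (verts F)" using simple_graph_finite(1)[OF F[OF FF]] .
  have "card (verts F - S) \<le> card (verts G - L)"
    using large[OF FF] card_mono[OF finF, of "verts F - S"] by simp
  then obtain g where g: "inj_on g (verts F - S)" "g ` (verts F - S) \<subseteq> verts G - L"
    using finF simple_graph_finite(1)[OF G] by (metis card_le_inj finite_Diff)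
  define h where "h = (\<lambda>p. if p \<in> S then f p else g p)"
  have S0: "S \<subseteq> verts F" using S by (simp add: covering_def)
  have h: "inj_on h S" "inj_on h (verts F - S)" "h ` S \<subseteq> L" "h ` (verts F - S) \<subseteq> verts G - L"
    using f g by (auto simp: h_def inj_on_def)
  have "contains_subgraph G F"
  proof (rule contains_subgraphI[of h])
    have "inj_on h (S \<union> (verts F - S))" using h by (subst inj_on_Un) blast
    then show "inj_on h (verts F)" using S0 by (simp add: Un_absorb1)
    show "h ` verts F \<subseteq> verts G" using h(3,4) L by blast
    fix e assume e: "e \<in> edges F"
    show "h ` e \<in> edges G"
    proof (cases "e \<subseteq> S")
      case True
      then have "h ` e = f ` e" by (auto simp: h_def)
      then show ?thesis using f(3)[OF e True] by simp
    next
      case False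
      obtain a b where ab: "a \<in> verts F" "b \<in> verts F" "e = {a, b}"
        using F[OF FF] e by (rule simple_graphE)
      have "e \<inter> S \<noteq> {}" using S e by (auto simp: covering_def)
      then obtain u v where uv: "u \<in> S" "v \<in> verts F - S" "e = {u, v}"
        using False ab by (auto simp: insert_commute)
      then have "{h u, h v} \<in> edges G" using h(3,4) by (intro joined) auto
      then show ?thesis using uv(3) by simp
    qed
  qed
  then show False using free[OF FF] by blast
qed

lemma beta_le_card: "covering F S \<Longrightarrow> beta F \<le> enat (card S)"
  unfolding beta_def by (rule INF_lower) simp

text \<open>If the two covering numbers agree, both sides are true: a complete graph on
  \<open>k + 1\<close> vertices does not fit into \<open>T\<close>, and no member of the family has
  a covering of size at most \<open>k\<close>. Otherwise both sides speak of the same induced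
  subgraphs.\<close>

lemma H_family_free_iff:
  assumes b: "family_beta' \<F> = enat (Suc k)" and T: "finite (verts T)" "card (verts T) = k"
  shows "(\<forall>X\<in>H_family \<F>. \<not> contains_subgraph T X) \<longleftrightarrow> core_free \<F> k T"
proof (cases "family_beta' \<F> = family_beta \<F>")
  case True
  have "\<not> contains_subgraph T (complete_graph (Suc k))"
  proof
    assume "contains_subgraph T (complete_graph (Suc k))"
    then obtain f where "inj_on f {..<Suc k}" "f ` {..<Suc k} \<subseteq> verts T"
      by (auto elim!: contains_subgraphE simp: complete_graph_def)
    then have "card {..<Suc k} \<le> card (verts T)" using T(1) card_inj_on_le by blast
    then show False using T(2) by simp
  qed
  moreover have "core_free \<F> k T"
  proof -
    have "Suc k \<le> card S" if "F \<in> \<F>" "covering F S" for F S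
    proof -
      have "enat (Suc k) \<le> beta F" using True b that(1) unfolding family_beta_def by (metis INF_lower)
      also have "\<dots> \<le> enat (card S)" using that(2) by (rule beta_le_card)
      finally show ?thesis by simp
    qed
    then show ?thesis unfolding core_free_def by fastforce
  qed
  moreover have "H_family \<F> = {complete_graph (Suc k)}"
    unfolding H_family_def using True b by (metis the_enat.simps)
  ultimately show ?thesis by simp
next
  case False
  then show ?thesis
    by (auto simp: H_family_def M_family_def core_free_def b less_Suc_eq_le)
qed

section \<open>Splitting the edges along a complete join\<close>

definition cross :: "'a set \<Rightarrow> 'a set \<Rightarrow> 'a set set" where
  "cross A B = {{u, v} | u v. u \<in> A \<and> v \<in> B}"

lemma finite_cross: "finite A \<Longrightarrow> finite B \<Longrightarrow> finite (cross A B)"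
  by (rule finite_subset[of _ "(\<lambda>(u, v). {u, v}) ` (A \<times> B)"]) (auto simp: cross_def)

lemma sum_edges_split:
  fixes g :: "'a set \<Rightarrow> 'b::comm_monoid_add"
  assumes G: "simple_graph G" and V: "verts G = L \<union> R" "L \<inter> R = {}" and c: "cross L R \<subseteq> edges G"
  shows "sum g (edges G)
    = sum g {e\<in>edges G. e \<subseteq> L} + sum g (cross L R) + sum g {e\<in>edges G. e \<subseteq> R}"
proof -
  have fin: "finite (edges G)" using finite_edges[OF G] .
  have "e \<subseteq> L \<or> e \<in> cross L R \<or> e \<subseteq> R" if e: "e \<in> edges G" for e
  proof -
    obtain u v where "u \<in> L \<union> R" "v \<in> L \<union> R" "e = {u, v}"
      using simple_graphE[OF G e] V(1) by metis
    then show ?thesis by (auto simp: cross_def insert_commute)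
  qed
  then have E: "edges G = {e\<in>edges G. e \<subseteq> L} \<union> cross L R \<union> {e\<in>edges G. e \<subseteq> R}" using c by blast
  have nonempty: "e \<noteq> {}" if "e \<in> edges G" for e using simple_graphE[OF G that] by auto
  have d1: "{e\<in>edges G. e \<subseteq> L} \<inter> cross L R = {}" using V(2) by (auto simp: cross_def)
  have d2: "({e\<in>edges G. e \<subseteq> L} \<union> cross L R) \<inter> {e\<in>edges G. e \<subseteq> R} = {}"
  proof -
    have "e = {}" if "e \<subseteq> L" "e \<subseteq> R" for e using that V(2) by blast
    moreover have "\<not> e \<subseteq> R" if "e \<in> cross L R" for e using that V(2) by (auto simp: cross_def)
    ultimately show ?thesis using nonempty by blast
  qed
  have finc: "finite (cross L R)" using fin c finite_subset by blast
  show ?thesis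
    by (subst E, subst sum.union_disjoint[OF _ _ d2])
      (use fin finc in \<open>simp_all add: sum.union_disjoint[OF _ _ d1]\<close>)
qed

section \<open>Spectrally extremal graphs\<close>

lemma sum_cross:
  fixes g :: "'a set \<Rightarrow> 'b::comm_monoid_add"
  assumes "finite A" "finite B" "A \<inter> B = {}"
  shows "sum g (cross A B) = (\<Sum>u\<in>A. \<Sum>v\<in>B. g {u, v})"
proof -
  have "inj_on (\<lambda>(u, v). {u, v}) (A \<times> B)"
    using assms(3) by (fastforce simp: inj_on_def doubleton_eq_iff)
  moreover have "cross A B = (\<lambda>(u, v). {u, v}) ` (A \<times> B)" by (auto simp: cross_def)
  ultimately have "sum g (cross A B) = (\<Sum>p\<in>A \<times> B. g (case p of (u, v) \<Rightarrow> {u, v}))"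
    by (simp add: sum.reindex)
  also have "\<dots> = (\<Sum>p\<in>A \<times> B. case p of (u, v) \<Rightarrow> g {u, v})"
    by (intro sum.cong) auto
  also have "\<dots> = (\<Sum>u\<in>A. \<Sum>v\<in>B. g {u, v})"
    by (simp add: sum.cartesian_product)
  finally show ?thesis .
qed

text \<open>The join of \<open>T\<close> with an edgeless graph, realised with \<open>T\<close> kept
  in place inside \<open>{..<n}\<close>. Its edge weight can thus be compared at the eigenvector of
  another graph on the same vertices.\<close>

definition join_on :: "nat \<Rightarrow> nat sgraph \<Rightarrow> nat sgraph" where
  "join_on n T = \<lparr>verts = {..<n}, edges = edges T \<union> cross (verts T) ({..<n} - verts T)\<rparr>"

lemma join_on_simps [simp]:
  "verts (join_on n T) = {..<n}"
  "edges (join_on n T) = edges T \<union> cross (verts T) ({..<n} - verts T)"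
  by (simp_all add: join_on_def)

lemma simple_join_on:
  assumes T: "simple_graph T" "verts T \<subseteq> {..<n}"
  shows "simple_graph (join_on n T)"
  unfolding simple_graph_def
proof (intro conjI ballI)
  fix e assume "e \<in> edges (join_on n T)"
  then consider "e \<in> edges T" | "e \<in> cross (verts T) ({..<n} - verts T)" by auto
  then show "\<exists>u\<in>verts (join_on n T). \<exists>v\<in>verts (join_on n T). u \<noteq> v \<and> e = {u, v}"
  proof cases
    case 1
    obtain u v where "u \<in> verts T" "v \<in> verts T" "u \<noteq> v" "e = {u, v}"
      using T(1) 1 by (rule simple_graphE)
    then show ?thesis using T(2) by auto
  next
    case 2
    then obtain u v where "u \<in> verts T" "v \<in> {..<n} - verts T" "e = {u, v}"
      by (auto simp: cross_def)
    then have "u \<in> {..<n}" "v \<in> {..<n}" "u \<noteq> v" "e = {u, v}" using T(2) by auto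
    then show ?thesis unfolding join_on_simps by blast
  qed
qed simp

lemma normalized_perron_vector:
  assumes "simple_graph G" "verts G = {..<n}" "0 < n"
  shows "\<exists>x. (\<forall>i. 0 \<le> x i) \<and> (\<forall>i<n. x i \<le> 1) \<and> (\<exists>i<n. x i = 1) \<and>
    (\<forall>i<n. (\<Sum>j\<in>nbrs G i. x j) = largest_eigenvalue n G * x i)"
proof -
  obtain y where y: "\<And>i. 0 \<le> y i" "(\<Sum>i<n. (y i)^2) = 1"
    "\<And>i. i < n \<Longrightarrow> (\<Sum>j\<in>nbrs G i. y j) = largest_eigenvalue n G * y i"
    using largest_eigenvalue_perron(2)[OF assms] by blast
  define M where "M = Max (y ` {..<n})"
  have "M \<in> y ` {..<n}" unfolding M_def using assms(3) by (intro Max_in) auto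
  then obtain p where p: "p < n" "y p = M" by auto
  have le: "y i \<le> M" if "i < n" for i unfolding M_def using that by (intro Max_ge) auto
  have "M > 0"
  proof (rule ccontr)
    assume "\<not> M > 0"
    then have "y i = 0" if "i < n" for i using le[OF that] y(1)[of i] by linarith
    then show False using y(2) by simp
  qed
  define x where "x = (\<lambda>i. y i / M)"
  have "(\<Sum>j\<in>nbrs G i. x j) = largest_eigenvalue n G * x i" if "i < n" for i
    using y(3)[OF that] by (simp add: x_def sum_divide_distrib[symmetric])
  moreover have "\<forall>i. 0 \<le> x i" "\<forall>i<n. x i \<le> 1" "x p = 1"
    using y(1) le \<open>M > 0\<close> p by (auto simp: x_def)
  ultimately show ?thesis using p(1) by blast
qed

text \<open>Isolates the contribution of \<open>v\<close>, for comparing graphs that differ only in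
  the edges at \<open>v\<close>.\<close>

lemma edge_weight_split_vertex:
  assumes "simple_graph G"
  shows "edge_weight G x
    = (\<Sum>e\<in>{e\<in>edges G. v \<notin> e}. \<Prod>i\<in>e. x i) + x v * (\<Sum>j\<in>nbrs G v. x j)"
proof -
  have fin: "finite (edges G)" using finite_edges[OF assms] .
  have star: "{e\<in>edges G. v \<in> e} = (\<lambda>w. {v, w}) ` nbrs G v"
  proof
    show "{e\<in>edges G. v \<in> e} \<subseteq> (\<lambda>w. {v, w}) ` nbrs G v"
    proof
      fix e assume "e \<in> {e\<in>edges G. v \<in> e}"
      then have e: "e \<in> edges G" "v \<in> e" by auto
      obtain a b where ab: "e = {a, b}" using assms e(1) by (rule simple_graphE)
      then have "e = {v, a} \<or> e = {v, b}" using e(2) by auto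
      then show "e \<in> (\<lambda>w. {v, w}) ` nbrs G v" using e(1) by (auto simp: nbrs_def)
    qed
  qed (auto simp: nbrs_def)
  have "edges G = {e\<in>edges G. v \<notin> e} \<union> {e\<in>edges G. v \<in> e}" by auto
  then have "edge_weight G x = (\<Sum>e\<in>{e\<in>edges G. v \<notin> e} \<union> {e\<in>edges G. v \<in> e}. \<Prod>i\<in>e. x i)"
    unfolding edge_weight_def by simp
  also have "\<dots> = (\<Sum>e\<in>{e\<in>edges G. v \<notin> e}. \<Prod>i\<in>e. x i) + (\<Sum>e\<in>{e\<in>edges G. v \<in> e}. \<Prod>i\<in>e. x i)"
    using fin by (intro sum.union_disjoint) auto
  also have "(\<Sum>e\<in>{e\<in>edges G. v \<in> e}. \<Prod>i\<in>e. x i) = (\<Sum>w\<in>nbrs G v. \<Prod>i\<in>{v, w}. x i)"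
    unfolding star by (subst sum.reindex) (auto simp: inj_on_def doubleton_eq_iff)
  also have "\<dots> = (\<Sum>w\<in>nbrs G v. x v * x w)"
  proof (rule sum.cong[OF refl])
    fix w assume "w \<in> nbrs G v"
    then have "v \<noteq> w" using nbrs_simple(2)[OF assms, of v] by auto
    then show "(\<Prod>i\<in>{v, w}. x i) = x v * x w" by simp
  qed
  finally show ?thesis by (simp add: sum_distrib_left)
qed

text \<open>The family is represented by constants that do not depend on \<open>n\<close>. In the
  application \<open>k + 1\<close> is the independent covering number, \<open>c\<close> bounds the
  orders of the members, \<open>C\<close> is the linear edge constant and \<open>m\<close> limits
  common neighbourhoods of \<open>k + 1\<close> vertices.\<close>

locale degenerate_family =
  fixes \<F> :: "nat sgraph set" and k m c :: nat and C :: real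
  assumes family_simple: "\<And>F. F \<in> \<F> \<Longrightarrow> simple_graph F"
    and family_k: "1 \<le> k" and family_C: "1 \<le> C"
    and family_order: "\<And>F. F \<in> \<F> \<Longrightarrow> card (verts F) \<le> c"
    and independent_covering_large:
      "\<And>F S. F \<in> \<F> \<Longrightarrow> covering F S \<Longrightarrow> independent_set F S \<Longrightarrow> k < card S"
    and family_linear: "\<forall>n. \<forall>G\<in>free_graphs n \<F>. real (card (edges G)) \<le> C * n"
    and family_few_common: "\<And>n G S. G \<in> free_graphs n \<F> \<Longrightarrow> S \<subseteq> {..<n} \<Longrightarrow> card S = Suc k \<Longrightarrow>
      card (common_nbrs G S) < m"
begin

lemma join_on_free:
  assumes T: "simple_graph T" "verts T \<subseteq> {..<n}" "card (verts T) = k" "core_free \<F> k T"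
  shows "join_on n T \<in> free_graphs n \<F>"
proof -
  have s: "simple_graph (join_on n T)" using T(1,2) by (rule simple_join_on)
  have "\<not> contains_subgraph (join_on n T) F" if F: "F \<in> \<F>" for F
  proof (rule free_of_core_free[OF F family_simple[OF F] s _ T(3)])
    show "verts T \<subseteq> verts (join_on n T)" using T(2) by simp
    show "e \<inter> verts T \<noteq> {}" if "e \<in> edges (join_on n T)" for e
    proof (cases "e \<in> edges T")
      case True
      then show ?thesis using simple_graphE[OF T(1) True] by auto
    next
      case False
      then show ?thesis using that by (auto simp: cross_def)
    qed
    have "contains_subgraph T (induced_subgraph (join_on n T) (verts T))"
      by (rule contains_subgraphI[of id]) (auto simp: cross_def)
    then show "core_free \<F> k (induced_subgraph (join_on n T) (verts T))"
      using core_free_contains T(4) by blast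
  qed
  then show ?thesis using s by (simp add: free_graphs_def)
qed

text \<open>If \<open>F[S]\<close> embeds into an edgeless graph, then \<open>S\<close> is an
  independent covering and has more than \<open>k\<close> elements.\<close>

lemma core_free_edgeless: "core_free \<F> k \<lparr>verts = L, edges = {}\<rparr>"
  unfolding core_free_def
proof (intro ballI allI impI notI)
  fix F S assume F: "F \<in> \<F>" and S: "covering F S" "card S \<le> k"
    and "contains_subgraph \<lparr>verts = L, edges = {}\<rparr> (induced_subgraph F S)"
  then have "\<forall>e\<in>edges F. \<not> e \<subseteq> S" by (auto elim!: contains_subgraphE)
  then have "independent_set F S" using S(1) by (simp add: independent_set_def covering_def)
  then show False using independent_covering_large[OF F S(1)] S(2) by simp
qed

text \<open>The complete bipartite graph with parts of size \<open>k\<close> and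
  \<open>n - k\<close> is free, and its Rayleigh quotient at its own Perron vector gives the
  bound.\<close>

lemma Ex_sp_eigenvalue_ge:
  assumes G: "G \<in> Ex_sp n \<F>" and n: "k < n"
  shows "sqrt (real k * (real n - real k)) \<le> largest_eigenvalue n G"
proof -
  let ?T = "\<lparr>verts = {..<k}, edges = {}\<rparr> :: nat sgraph"
  let ?G = "join_on n ?T"
  have sT: "simple_graph ?T" by (simp add: simple_graph_def)
  have free: "?G \<in> free_graphs n \<F>"
    using sT n core_free_edgeless by (intro join_on_free) auto
  define q where "q = sqrt (real k * (real n - real k))"
  \<comment> \<open>With these entries every cross edge has weight \<open>q\<close>, and both parts
    contribute \<open>k * (n - k)\<close> to the squared norm.\<close>
  define y where "y = (\<lambda>i. if i < k then sqrt (real n - real k) else sqrt (real k))"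
  have pos: "0 < real k" "0 < real n - real k" using family_k n by auto
  have R: "{..<n} - {..<k} = {k..<n}" by auto
  have "edges ?G = cross {..<k} {k..<n}" by (simp add: R)
  then have "edge_weight ?G y = (\<Sum>u<k. \<Sum>v\<in>{k..<n}. \<Prod>i\<in>{u, v}. y i)"
    unfolding edge_weight_def by (simp only:) (rule sum_cross, auto)
  also have "\<dots> = (\<Sum>u<k. \<Sum>v\<in>{k..<n}. q)"
    by (intro sum.cong refl) (auto simp: y_def q_def real_sqrt_mult)
  also have "\<dots> = real k * (real n - real k) * q" using n by simp
  finally have ew: "edge_weight ?G y = real k * (real n - real k) * q" .
  have "(\<Sum>i<n. (y i)^2) = (\<Sum>i\<in>{..<k} \<union> {k..<n}. (y i)^2)"
    using n by (intro sum.cong) auto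
  also have "\<dots> = (\<Sum>i<k. (y i)^2) + (\<Sum>i\<in>{k..<n}. (y i)^2)"
    by (intro sum.union_disjoint) auto
  also have "\<dots> = (\<Sum>i<k. real n - real k) + (\<Sum>i\<in>{k..<n}. real k)"
    using pos by (intro arg_cong2[of _ _ _ _ "(+)"] sum.cong) (auto simp: y_def)
  also have "\<dots> = 2 * (real k * (real n - real k))" using n by (simp add: algebra_simps)
  finally have ny: "(\<Sum>i<n. (y i)^2) = 2 * (real k * (real n - real k))" .
  have "2 * edge_weight ?G y \<le> largest_eigenvalue n ?G * (\<Sum>i<n. (y i)^2)"
    using free n by (intro largest_eigenvalue_perron(1)) (auto simp: free_graphs_def)
  then have "(2 * (real k * (real n - real k))) * q \<le> (2 * (real k * (real n - real k))) * largest_eigenvalue n ?G"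
    unfolding ew ny by (simp only: mult_ac)
  then have "q \<le> largest_eigenvalue n ?G" using pos by (subst (asm) mult_le_cancel_left_pos) auto
  also have "\<dots> \<le> largest_eigenvalue n G" using G free by (simp add: Ex_sp_def)
  finally show ?thesis by (simp add: q_def)
qed

lemma Ex_sp_sparse_perron:
  assumes G: "G \<in> Ex_sp n \<F>" and n: "2 * k \<le> n"
  shows "\<exists>x. sparse_perron_graph G n k m (2 * C) (largest_eigenvalue n G) x"
proof -
  have free: "G \<in> free_graphs n \<F>" using G by (simp add: Ex_sp_def)
  have sG: "simple_graph G" "verts G = {..<n}" using free by (auto simp: free_graphs_def)
  have kn: "k < n" using n family_k by linarith
  define q where "q = real k * (real n - real k)"
  have q: "0 < q" using family_k kn by (simp add: q_def)
  have lam: "sqrt q \<le> largest_eigenvalue n G" using Ex_sp_eigenvalue_ge[OF G kn] by (simp add: q_def)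
  then have lam0: "0 < largest_eigenvalue n G" using q by (smt (verit) real_sqrt_gt_zero)
  have "q = (sqrt q)^2" using q by simp
  also have "\<dots> \<le> (largest_eigenvalue n G)^2" using lam q by (intro power_mono) auto
  finally have lam2: "real k * (real n - real k) \<le> (largest_eigenvalue n G)^2" by (simp add: q_def)
  obtain x where "\<forall>i. 0 \<le> x i" "\<forall>i<n. x i \<le> 1" "\<exists>i<n. x i = 1"
    "\<forall>i<n. (\<Sum>j\<in>nbrs G i. x j) = largest_eigenvalue n G * x i"
    using normalized_perron_vector[OF sG] kn by auto
  then have "sparse_perron_graph G n k m (2 * C) (largest_eigenvalue n G) x"
  proof (unfold_locales, goal_cases)
    case 3
    then show ?case using free_graphs_sparse[OF family_linear free] by blast
  next
    case 4
    then show ?case using family_few_common[OF free] by blast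
  qed (use sG family_k family_C n lam0 lam2 in auto)
  then show ?thesis by blast
qed

end

text \<open>Besides the properties of \<open>L\<close>, this fixes how small \<open>e\<close> and
  how large \<open>n\<close> must be. \<open>e_common\<close> drives the reattachment of a vertex,
  \<open>e_edges\<close> the comparison inside \<open>L\<close>, \<open>n_large\<close> provides
  more than \<open>c\<close> common neighbours of \<open>L\<close>, and \<open>lam_large\<close>
  drives the comparison of edges outside \<open>L\<close>.\<close>

locale dominant_pair = degenerate_family \<F> k m c C
    + sparse_perron_graph G n k m "2 * C" "largest_eigenvalue n G" x
  for \<F> k m c C G n x +
  fixes L :: "nat set" and e :: real
  assumes extremal: "G \<in> Ex_sp n \<F>"
    and L_sub: "L \<subseteq> {..<n}" and card_L: "card L = k" and x_L: "\<And>v. v \<in> L \<Longrightarrow> 1 - e \<le> x v"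
    and defect: "card ({..<n} - common_nbrs G L) \<le> e * n"
    and x_small: "\<And>v. v < n \<Longrightarrow> v \<notin> L \<Longrightarrow> x v \<le> e"
    and e_pos: "0 < e" and e_common: "(m + 2 * C + 1) * e < 1"
    and e_edges: "(2 * real k^2 + 2 * c * m) * e < 1"
    and n_large: "real c + real k + e * n < n"
    and lam_large: "2 * (2 * real c * m + 1) * m < largest_eigenvalue n G"

text \<open>Once \<open>e\<close> is fixed, all auxiliary constants are fixed too, and every
  remaining requirement is a lower bound on \<open>n\<close>. Requirements on the eigenvalue are of
  this kind because its square is at least \<open>n / 2\<close>.\<close>

lemma (in degenerate_family) eventually_dominant_pair:
  assumes e: "0 < e" "(m + 2 * C + 1) * e < 1" "(2 * real k^2 + 2 * c * m) * e < 1"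
  shows "\<forall>\<^sub>F n in sequentially. \<forall>G\<in>Ex_sp n \<F>. \<exists>x L. dominant_pair \<F> k m c C G n x L e"
proof -
  define D where "D = 2 * C"
  define d where "d = e / (6 * k^2)"
  define s where "s = d / (2 * D)"
  define M where "M = nat \<lfloor>8 * D^2 / s\<rfloor>"
  define K where "K = max (32 * D^3 / s^2) (2 * (2 * real c * m + 1) * m + 1)"
  have "1 * e \<le> (m + 2 * C + 1) * e" using e(1) family_C by (intro mult_right_mono) auto
  then have e1: "e < 1" using e(2) by simp
  have d0: "0 < d" using e(1) family_k by (simp add: d_def)
  have ev: "\<forall>\<^sub>F n in sequentially. Z \<le> real n" for Z
    using filterlim_real_sequentially by (simp add: filterlim_at_top)
  \<comment> \<open>The four bounds make the eigenvalue at least \<open>K\<close>, allow the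
    comparison with the complete bipartite graph, absorb the bounded errors of
    \<open>dominant_set\<close>, and yield \<open>n_large\<close>.\<close>
  show ?thesis
    using ev[of "2 * K^2"] ev[of "2 * k"] ev[of "2 * (m * 2 ^ Suc M * M + real k^2 + k * m + 1) / d"]
      ev[of "(real c + real k + 1) / (1 - e)"]
  proof eventually_elim
    case (elim n)
    show ?case
    proof
      fix G assume G: "G \<in> Ex_sp n \<F>"
      have n2: "2 * k \<le> n" using elim(2) by simp
      obtain x where x: "sparse_perron_graph G n k m (2 * C) (largest_eigenvalue n G) x"
        using Ex_sp_sparse_perron[OF G n2] by blast
      interpret P: sparse_perron_graph G n k m "2 * C" "largest_eigenvalue n G" x by (rule x)
      have "K^2 \<le> (largest_eigenvalue n G)^2" using elim(1) P.lam_sq_ge by linarith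
      then have K: "K \<le> largest_eigenvalue n G"
        using P.lam_pos by (rule power2_le_imp_le[OF _ less_imp_le])
      have "2 * (m * 2 ^ Suc M * M + real k^2 + k * m + 1) \<le> d * n"
        using elim(3) d0 by (simp add: field_simps)
      then have n3: "m * 2 ^ Suc M * M + real k^2 + k * m < d * n / 2" by simp
      have "32 * (2 * C)^3 / s^2 \<le> largest_eigenvalue n G" using K by (simp add: K_def D_def)
      then obtain L where L: "L \<subseteq> {..<n}" "card L = k" "\<And>v. v \<in> L \<Longrightarrow> 1 - e \<le> x v"
        "card ({..<n} - common_nbrs G L) \<le> e * n" "\<And>v. v < n \<Longrightarrow> v \<notin> L \<Longrightarrow> x v \<le> e"
        using P.dominant_set[of e] e(1) e1 n3 unfolding M_def s_def d_def D_def by (metis less_imp_le)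
      have n4: "real c + real k + e * n < n"
      proof -
        have "real c + real k + 1 \<le> n * (1 - e)" using elim(4) e1 by (simp add: field_simps)
        then show ?thesis by (simp add: algebra_simps)
      qed
      have lam: "2 * (2 * real c * m + 1) * m < largest_eigenvalue n G" using K by (simp add: K_def)
      have "dominant_pair \<F> k m c C G n x L e"
        by unfold_locales (use G L e n4 lam in auto)
      then show "\<exists>x L. dominant_pair \<F> k m c C G n x L e" by blast
    qed
  qed
qed

section \<open>The complete join\<close>

context dominant_pair
begin

lemma G_free: "G \<in> free_graphs n \<F>" using extremal by (simp add: Ex_sp_def)

lemma edge_weight_eigen: "2 * edge_weight G x = largest_eigenvalue n G * (\<Sum>i<n. (x i)^2)"
proof -
  have "2 * edge_weight G x = (\<Sum>i<n. x i * (\<Sum>j\<in>nbrs G i. x j))"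
    using edge_weight_eq_sum_nbrs[OF simple] vertsG by simp
  also have "\<dots> = (\<Sum>i<n. largest_eigenvalue n G * (x i)^2)"
    by (intro sum.cong) (auto simp: eigen power2_eq_square)
  finally show ?thesis by (simp add: sum_distrib_left)
qed

text \<open>Spectral extremality becomes a statement about one fixed weighting: \<open>x\<close>
  need not be an eigenvector of \<open>G'\<close>, but the Rayleigh bound for \<open>G'\<close>
  holds at it. All later modifications of \<open>G\<close> are tested at this
  \<open>x\<close>.\<close>

lemma edge_weight_free_le:
  assumes "G' \<in> free_graphs n \<F>"
  shows "edge_weight G' x \<le> edge_weight G x"
proof -
  have G': "simple_graph G'" "verts G' = {..<n}" using assms by (auto simp: free_graphs_def)
  have "2 * edge_weight G' x \<le> largest_eigenvalue n G' * (\<Sum>i<n. (x i)^2)"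
    using largest_eigenvalue_perron(1)[OF G'] k_pos n_ge by simp
  also have "\<dots> \<le> largest_eigenvalue n G * (\<Sum>i<n. (x i)^2)"
    using extremal assms by (intro mult_right_mono sum_nonneg) (auto simp: Ex_sp_def)
  finally show ?thesis using edge_weight_eigen by simp
qed

lemma eigen_of_edge_weight_ge:
  assumes "G' \<in> free_graphs n \<F>" "edge_weight G x \<le> edge_weight G' x" "i < n"
  shows "(\<Sum>j\<in>nbrs G' i. x j) = (\<Sum>j\<in>nbrs G i. x j)"
proof -
  have "(\<Sum>j\<in>nbrs G' i. x j) = largest_eigenvalue n G * x i"
  proof (rule eigenvector_of_edge_weight_maximal)
    show "largest_eigenvalue n G' \<le> largest_eigenvalue n G"
      using extremal assms(1) by (auto simp: Ex_sp_def)
    show "largest_eigenvalue n G * (\<Sum>i<n. (x i)^2) \<le> 2 * edge_weight G' x"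
      using edge_weight_eigen assms(2) by simp
  qed (use assms in \<open>auto simp: free_graphs_def\<close>)
  then show ?thesis using eigen[OF assms(3)] by simp
qed

lemma finite_L: "finite L" using L_sub finite_subset by blast

lemma common_nbrs_subset: "common_nbrs G L \<subseteq> {..<n} - L"
  using nbrs_simple(2)[OF simple] vertsG by (auto simp: common_nbrs_def)

lemma finite_common_nbrs: "finite (common_nbrs G L)"
  using common_nbrs_subset finite_subset by blast

lemma card_common_nbrs: "c < card (common_nbrs G L)"
proof -
  have "common_nbrs G L \<subseteq> {..<n}" using common_nbrs_subset by auto
  then have "card ({..<n} - common_nbrs G L) = n - card (common_nbrs G L)"
    using finite_common_nbrs by (simp add: card_Diff_subset)
  then have "real n \<le> e * n + card (common_nbrs G L)" using defect by linarith
  then show ?thesis using n_large by linarith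
qed

lemma few_nbrs_common:
  assumes "v < n" "v \<notin> L"
  shows "card (nbrs G v \<inter> common_nbrs G L) < m"
proof -
  have "nbrs G v \<inter> common_nbrs G L \<subseteq> common_nbrs G (insert v L)"
    by (auto simp: common_nbrs_def nbrs_sym)
  then have "card (nbrs G v \<inter> common_nbrs G L) \<le> card (common_nbrs G (insert v L))"
    by (intro card_mono) (auto simp: common_nbrs_def vertsG)
  also have "\<dots> < m" using assms L_sub card_L finite_L by (intro few_common) auto
  finally show ?thesis .
qed

definition reattach :: "nat \<Rightarrow> nat sgraph" where
  "reattach v = \<lparr>verts = {..<n}, edges = {a \<in> edges G. v \<notin> a} \<union> (\<lambda>u. {v, u}) ` L\<rparr>"

lemma reattach_free:
  assumes v: "v < n" "v \<notin> L" "v \<notin> common_nbrs G L"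
  shows "reattach v \<in> free_graphs n \<F>"
proof -
  have "simple_graph (reattach v)"
    unfolding simple_graph_def
  proof (intro conjI ballI)
    fix a assume "a \<in> edges (reattach v)"
    then consider "a \<in> edges G" | u where "u \<in> L" "a = {v, u}" by (auto simp: reattach_def)
    then show "\<exists>p\<in>verts (reattach v). \<exists>q\<in>verts (reattach v). p \<noteq> q \<and> a = {p, q}"
    proof cases
      case 1
      obtain p q where "p \<in> verts G" "q \<in> verts G" "p \<noteq> q" "a = {p, q}"
        using simple 1 by (rule simple_graphE)
      then show ?thesis using vertsG by (auto simp: reattach_def)
    next
      case 2
      then have "v \<in> {..<n}" "u \<in> {..<n}" "v \<noteq> u" "a = {v, u}" using v L_sub by auto
      then show ?thesis by (auto simp: reattach_def)
    qed
  qed (simp add: reattach_def)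
  moreover have "\<not> contains_subgraph (reattach v) F" if F: "F \<in> \<F>" for F
  proof
    assume "contains_subgraph (reattach v) F"
    then obtain f where f: "inj_on f (verts F)" "f ` verts F \<subseteq> {..<n}"
      "\<forall>a\<in>edges F. f ` a \<in> edges (reattach v)"
      by (auto elim!: contains_subgraphE simp: reattach_def)
    have finF: "finite (verts F)" using simple_graph_finite(1)[OF family_simple[OF F]] .
    have "card (f ` verts F) \<le> c" using card_image_le[OF finF, of f] family_order[OF F] by linarith
    then have "\<not> common_nbrs G L \<subseteq> f ` verts F"
      using card_common_nbrs card_mono[OF finite_imageI[OF finF], of "common_nbrs G L" f] by linarith
    then obtain w where w: "w \<in> common_nbrs G L" "w \<notin> f ` verts F" by blast
    define g where "g = (\<lambda>p. if f p = v then w else f p)"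
    have "contains_subgraph G F"
    proof (rule contains_subgraphI[of g])
      show "inj_on g (verts F)"
      proof (rule inj_onI)
        fix p q assume "p \<in> verts F" "q \<in> verts F" "g p = g q"
        then show "p = q" using f(1) w(2) by (auto simp: g_def split: if_splits dest: inj_onD)
      qed
      show "g ` verts F \<subseteq> verts G"
        using f(2) w(1) common_nbrs_subset vertsG by (auto simp: g_def)
      fix a assume a: "a \<in> edges F"
      obtain p q where pq: "p \<in> verts F" "q \<in> verts F" "p \<noteq> q" "a = {p, q}"
        using family_simple[OF F] a by (rule simple_graphE)
      have fpq: "{f p, f q} \<in> edges (reattach v)" using f(3) a pq(4) by auto
      have ne: "f p \<noteq> f q" using f(1) pq by (auto dest: inj_onD)
      have wL: "{w, u} \<in> edges G" if "u \<in> L" for u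
        using w(1) that by (auto simp: common_nbrs_def nbrs_def)
      have at_v: "u \<in> L" if "{v, u} \<in> edges (reattach v)" "u \<noteq> v" for u
        using that by (auto simp: reattach_def doubleton_eq_iff)
      consider "f p = v" "f q \<noteq> v" | "f q = v" "f p \<noteq> v" | "f p \<noteq> v" "f q \<noteq> v" using ne by auto
      then show "g ` a \<in> edges G"
      proof cases
        case 1
        then show ?thesis using fpq wL[OF at_v[of "f q"]] pq(4) by (simp add: g_def insert_commute)
      next
        case 2
        then have "{v, f p} \<in> edges (reattach v)" using fpq by (simp add: insert_commute)
        then show ?thesis
          using 2 wL[OF at_v[of "f p"]] pq(4) by (simp add: g_def insert_commute)
      next
        case 3
        then have "{f p, f q} \<in> edges G" using fpq by (auto simp: reattach_def doubleton_eq_iff)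
        then show ?thesis using 3 pq(4) by (simp add: g_def)
      qed
    qed
    then show False using G_free F by (auto simp: free_graphs_def)
  qed
  ultimately show ?thesis by (simp add: free_graphs_def reattach_def)
qed

text \<open>Some bad vertex \<open>v\<close> has at most \<open>m + 2 * C\<close> neighbours outside
  \<open>L\<close>. Their total weight is below \<open>1 - e\<close>, hence below the weight of a
  vertex of \<open>L\<close> missing from its neighbourhood, so exchanging the neighbourhood for
  \<open>L\<close> increases its weight.\<close>

lemma full_join: "common_nbrs G L = {..<n} - L"
proof (rule ccontr)
  define B where "B = {..<n} - L - common_nbrs G L"
  assume "common_nbrs G L \<noteq> {..<n} - L"
  then have "B \<noteq> {}" using common_nbrs_subset by (auto simp: B_def)
  have finB: "finite B" by (simp add: B_def)
  \<comment> \<open>By sparsity the average degree inside \<open>B\<close> is at most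
    \<open>2 * C\<close>.\<close>
  have "\<exists>v\<in>B. card (nbrs G v \<inter> B) \<le> 2 * C"
  proof (rule ccontr)
    assume "\<not> ?thesis"
    then have "(\<Sum>v\<in>B. 2 * C) < (\<Sum>v\<in>B. real (card (nbrs G v \<inter> B)))"
      using finB \<open>B \<noteq> {}\<close> by (intro sum_strict_mono) (auto simp: not_le)
    moreover have "(\<Sum>v\<in>B. real (card (nbrs G v \<inter> B))) \<le> 2 * C * card B"
      by (rule sparse) (auto simp: B_def)
    ultimately show False by (simp add: mult.commute)
  qed
  then obtain v where v: "v \<in> B" "card (nbrs G v \<inter> B) \<le> 2 * C" by blast
  then have vn: "v < n" "v \<notin> L" "v \<notin> common_nbrs G L" by (auto simp: B_def)
  have "nbrs G v - L \<subseteq> (nbrs G v \<inter> common_nbrs G L) \<union> (nbrs G v \<inter> B)"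
    using nbrs_subset[of v] by (auto simp: B_def)
  then have "card (nbrs G v - L) \<le> card ((nbrs G v \<inter> common_nbrs G L) \<union> (nbrs G v \<inter> B))"
    by (intro card_mono) auto
  also have "\<dots> \<le> card (nbrs G v \<inter> common_nbrs G L) + card (nbrs G v \<inter> B)" by (rule card_Un_le)
  finally have deg: "real (card (nbrs G v - L)) \<le> m + 2 * C"
    using few_nbrs_common[OF vn(1,2)] v(2) by linarith
  have "(\<Sum>j\<in>nbrs G v - L. x j) \<le> (\<Sum>j\<in>nbrs G v - L. e)"
    using nbrs_subset[of v] by (intro sum_mono x_small) auto
  also have "\<dots> \<le> (m + 2 * C) * e" using deg e_pos by simp
  also have "\<dots> < 1 - e" using e_common by (simp add: algebra_simps)
  finally have out: "(\<Sum>j\<in>nbrs G v - L. x j) < 1 - e" .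
  obtain u where u: "u \<in> L" "u \<notin> nbrs G v" using vn vertsG by (auto simp: common_nbrs_def)
  have "(\<Sum>j\<in>nbrs G v \<inter> L. x j) + x u = (\<Sum>j\<in>insert u (nbrs G v \<inter> L). x j)"
    using u by (subst sum.insert) auto
  also have "\<dots> \<le> (\<Sum>j\<in>L. x j)" using u finite_L x_nonneg by (intro sum_mono2) auto
  finally have inn: "(\<Sum>j\<in>nbrs G v \<inter> L. x j) + (1 - e) \<le> (\<Sum>j\<in>L. x j)" using x_L[OF u(1)] by linarith
  have "(\<Sum>j\<in>nbrs G v. x j) = (\<Sum>j\<in>nbrs G v \<inter> L. x j) + (\<Sum>j\<in>nbrs G v - L. x j)"
    by (rule sum.Int_Diff) simp
  then have less: "(\<Sum>j\<in>nbrs G v. x j) < (\<Sum>j\<in>L. x j)" using out inn by linarith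
  have free: "reattach v \<in> free_graphs n \<F>" using reattach_free[OF vn] .
  then have sG': "simple_graph (reattach v)" by (simp add: free_graphs_def)
  have nb: "nbrs (reattach v) v = L"
    using vn(2) by (auto simp: nbrs_def reattach_def doubleton_eq_iff)
  have rest: "{a\<in>edges (reattach v). v \<notin> a} = {a\<in>edges G. v \<notin> a}" by (auto simp: reattach_def)
  have "edge_weight G x \<le> edge_weight (reattach v) x"
    unfolding edge_weight_split_vertex[OF simple, of x v] edge_weight_split_vertex[OF sG', of x v] nb rest
    using less x_nonneg[of v] by (simp add: mult_left_mono)
  \<comment> \<open>As \<open>x v\<close> might be 0, the edge weight need not grow strictly. Even a
    tie makes \<open>x\<close> an eigenvector of the new graph, and the eigenvalue equation at
    \<open>v\<close> then contradicts the strict inequality \<open>less\<close>.\<close>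
  from eigen_of_edge_weight_ge[OF free this vn(1)] less show False by (simp add: nb)
qed

lemma joined:
  assumes "u \<in> L" "v \<in> {..<n} - L"
  shows "{u, v} \<in> edges G"
proof -
  have "v \<in> common_nbrs G L" using assms(2) by (simp add: full_join)
  then have "u \<in> nbrs G v" using assms(1) by (auto simp: common_nbrs_def)
  then show ?thesis by (simp add: nbrs_def insert_commute)
qed

lemma cross_subset: "cross L ({..<n} - L) \<subseteq> edges G"
proof
  fix a assume "a \<in> cross L ({..<n} - L)"
  then obtain u v where "u \<in> L" "v \<in> {..<n} - L" "a = {u, v}" unfolding cross_def by blast
  then show "a \<in> edges G" using joined by simp
qed

lemma degree_rest:
  assumes "v \<in> {..<n} - L"
  shows "card (nbrs G v \<inter> ({..<n} - L)) < m"
  using few_nbrs_common assms by (simp add: full_join)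

lemma card_rest: "c < card ({..<n} - L)" using card_common_nbrs by (simp add: full_join)

lemma core_free_L: "core_free \<F> k (induced_subgraph G L)"
proof (rule core_free_of_free[OF family_simple simple])
  show "\<not> contains_subgraph G F" if "F \<in> \<F>" for F using that G_free by (simp add: free_graphs_def)
  show "card (verts F) \<le> card (verts G - L)" if "F \<in> \<F>" for F
    using family_order[OF that] card_rest vertsG by simp
qed (use joined vertsG L_sub in auto)

end

section \<open>Edges outside the dominant set\<close>

text \<open>Greedy choice: fewer than \<open>c\<close> chosen edges have at most
  \<open>2 * c\<close> ends, which meet at most \<open>2 * c * m\<close> edges inside
  \<open>R\<close>, so some edge avoids them all.\<close>

lemma exists_matching:
  assumes G: "simple_graph G" and R: "R \<subseteq> verts G"
    and deg: "\<And>v. v \<in> R \<Longrightarrow> card (nbrs G v \<inter> R) \<le> m"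
    and many: "2 * c * m < card {e \<in> edges G. e \<subseteq> R}" and j: "j \<le> c"
  shows "\<exists>a b. (\<forall>i<j. a i \<in> R \<and> b i \<in> R \<and> {a i, b i} \<in> edges G) \<and>
    inj_on a {..<j} \<and> inj_on b {..<j} \<and> (\<forall>i<j. \<forall>i'<j. a i \<noteq> b i')"
  using j
proof (induction j)
  case 0
  show ?case by simp
next
  case (Suc j)
  then obtain a b :: "nat \<Rightarrow> 'a" where
    ab': "\<forall>i<j. a i \<in> R \<and> b i \<in> R \<and> {a i, b i} \<in> edges G" "\<forall>i<j. \<forall>i'<j. a i \<noteq> b i'"
    and inj: "inj_on a {..<j}" "inj_on b {..<j}"
    by auto
  have ab: "\<And>i. i < j \<Longrightarrow> a i \<in> R" "\<And>i. i < j \<Longrightarrow> b i \<in> R"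
    "\<And>i. i < j \<Longrightarrow> {a i, b i} \<in> edges G" "\<And>i i'. i < j \<Longrightarrow> i' < j \<Longrightarrow> a i \<noteq> b i'"
    using ab' by auto
  define U where "U = a ` {..<j} \<union> b ` {..<j}"
  let ?E = "{e \<in> edges G. e \<subseteq> R}"
  have finU: "finite U" by (simp add: U_def)
  have "card U \<le> card (a ` {..<j}) + card (b ` {..<j})" unfolding U_def by (rule card_Un_le)
  also have "\<dots> \<le> j + j" using card_image_le[of "{..<j}"] by (intro add_mono) auto
  finally have cU: "card U \<le> 2 * j" by simp
  have "{e \<in> ?E. e \<inter> U \<noteq> {}} \<subseteq> (\<Union>u\<in>U. (\<lambda>w. {u, w}) ` (nbrs G u \<inter> R))"
  proof
    fix e assume "e \<in> {e \<in> ?E. e \<inter> U \<noteq> {}}"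
    then obtain u where e: "e \<in> edges G" "e \<subseteq> R" "u \<in> e" "u \<in> U" by auto
    obtain p q where "e = {p, q}" using G e(1) by (rule simple_graphE)
    then obtain w where "e = {u, w}" using e(3) by auto
    then have "w \<in> nbrs G u \<inter> R" using e by (auto simp: nbrs_def)
    then show "e \<in> (\<Union>u\<in>U. (\<lambda>w. {u, w}) ` (nbrs G u \<inter> R))" using \<open>e = {u, w}\<close> e(4) by blast
  qed
  then have "card {e \<in> ?E. e \<inter> U \<noteq> {}} \<le> card (\<Union>u\<in>U. (\<lambda>w. {u, w}) ` (nbrs G u \<inter> R))"
    using finU nbrs_simple(3)[OF G] by (intro card_mono) auto
  also have "\<dots> \<le> (\<Sum>u\<in>U. card ((\<lambda>w. {u, w}) ` (nbrs G u \<inter> R)))"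
    using finU by (rule card_UN_le)
  also have "\<dots> \<le> (\<Sum>u\<in>U. m)"
  proof (rule sum_mono)
    fix u assume "u \<in> U"
    then have "u \<in> R" using ab(1,2) by (auto simp: U_def)
    then show "card ((\<lambda>w. {u, w}) ` (nbrs G u \<inter> R)) \<le> m"
      using card_image_le[of "nbrs G u \<inter> R" "\<lambda>w. {u, w}"] nbrs_simple(3)[OF G] deg[of u]
      by fastforce
  qed
  also have "\<dots> \<le> 2 * c * m"
  proof -
    have "card U \<le> 2 * c" using cU Suc.prems by linarith
    then show ?thesis by simp
  qed
  also have "\<dots> < card ?E" by (rule many)
  finally have "{e \<in> ?E. e \<inter> U \<noteq> {}} \<noteq> ?E" by auto
  then obtain e where e: "e \<in> edges G" "e \<subseteq> R" "e \<inter> U = {}" by blast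
  obtain p q where pq: "p \<noteq> q" "e = {p, q}" using G e(1) by (rule simple_graphE)
  have new: "p \<in> R" "q \<in> R" "p \<notin> a ` {..<j}" "p \<notin> b ` {..<j}" "q \<notin> a ` {..<j}" "q \<notin> b ` {..<j}"
    "{p, q} \<in> edges G" using e pq by (auto simp: U_def)
  let ?a = "a(j := p)" and ?b = "b(j := q)"
  have "inj_on ?a {..<Suc j}" "inj_on ?b {..<Suc j}"
    using inj new by (auto simp: lessThan_Suc inj_on_fun_updI)
  moreover have "\<forall>i<Suc j. ?a i \<in> R \<and> ?b i \<in> R \<and> {?a i, ?b i} \<in> edges G"
    using ab(1-3) new by (auto simp: less_Suc_eq)
  moreover have "?a i \<noteq> ?b i'" if "i < Suc j" "i' < Suc j" for i i'
    using ab(4)[of i i'] new pq(1) that by (cases "i = j"; cases "i' = j") auto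
  ultimately show ?case by blast
qed

text \<open>The matching pairs consecutive vertices of the large side. For odd \<open>n - k\<close>
  the last vertex stays unmatched, which gives the floor in the hypothesis of the theorem.\<close>

definition matched_bipartite :: "nat \<Rightarrow> nat \<Rightarrow> nat sgraph" where
  "matched_bipartite k n = \<lparr>verts = {..<n},
     edges = cross {..<k} {k..<n} \<union> (\<lambda>i. {k + 2 * i, k + 2 * i + 1}) ` {..<(n - k) div 2}\<rparr>"

lemma simple_matched_bipartite:
  assumes "k \<le> n"
  shows "simple_graph (matched_bipartite k n)"
  unfolding simple_graph_def
proof (intro conjI ballI)
  fix e assume "e \<in> edges (matched_bipartite k n)"
  then consider u v where "u < k" "k \<le> v" "v < n" "e = {u, v}"
    | i where "i < (n - k) div 2" "e = {k + 2 * i, k + 2 * i + 1}"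
    by (auto simp: matched_bipartite_def cross_def)
  then show "\<exists>u\<in>verts (matched_bipartite k n). \<exists>v\<in>verts (matched_bipartite k n). u \<noteq> v \<and> e = {u, v}"
  proof cases
    case (1 u v)
    then have "u \<in> {..<n}" "v \<in> {..<n}" "u \<noteq> v" by auto
    then show ?thesis using 1(4) by (auto simp: matched_bipartite_def)
  next
    case (2 i)
    then have "k + 2 * i \<in> {..<n}" "k + 2 * i + 1 \<in> {..<n}" "k + 2 * i \<noteq> k + 2 * i + 1" by auto
    then show ?thesis using 2(2) unfolding matched_bipartite_def sgraph.simps by blast
  qed
qed (simp add: matched_bipartite_def)

lemma matched_bipartite_contains:
  assumes "k \<le> n"
  shows "contains_subgraph (matched_bipartite k n) (complete_bipartite k (n - k))"
    and "card (edges (complete_bipartite k (n - k))) + (n - k) div 2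
      \<le> card (edges (matched_bipartite k n))"
proof -
  define j :: "nat + nat \<Rightarrow> nat" where "j = case_sum (\<lambda>u. u) (\<lambda>v. k + v)"
  let ?K = "complete_bipartite k (n - k)"
  let ?M = "(\<lambda>i. {k + 2 * i, k + 2 * i + 1}) ` {..<(n - k) div 2}"
  have inj: "inj_on j (verts ?K)"
    by (auto simp: inj_on_def j_def complete_bipartite_def)
  have edge: "(`) j ` edges ?K \<subseteq> cross {..<k} {k..<n}"
  proof
    fix e assume "e \<in> (`) j ` edges ?K"
    then obtain u v where "u < k" "v < n - k" "e = j ` {Inl u, Inr v}"
      by (auto simp: complete_bipartite_def)
    then have "u \<in> {..<k}" "k + v \<in> {k..<n}" "e = {u, k + v}" by (auto simp: j_def)
    then show "e \<in> cross {..<k} {k..<n}" unfolding cross_def by blast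
  qed
  show "contains_subgraph (matched_bipartite k n) ?K"
  proof (rule contains_subgraphI[OF inj])
    show "j ` verts ?K \<subseteq> verts (matched_bipartite k n)"
      using assms by (auto simp: j_def complete_bipartite_def matched_bipartite_def)
    show "j ` e \<in> edges (matched_bipartite k n)" if "e \<in> edges ?K" for e
      using edge that by (auto simp: matched_bipartite_def)
  qed
  have "\<Union>(edges ?K) \<subseteq> verts ?K" by (auto simp: complete_bipartite_def)
  then have "inj_on j (\<Union>(edges ?K))" using inj inj_on_subset by blast
  then have "card (edges ?K) = card ((`) j ` edges ?K)" by (simp add: card_image inj_on_image)
  moreover have "card ?M = (n - k) div 2"
  proof -
    have "inj_on (\<lambda>i. {k + 2 * i, k + 2 * i + 1}) {..<(n - k) div 2}"
      by (auto simp: inj_on_def doubleton_eq_iff)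
    then show ?thesis by (simp add: card_image)
  qed
  moreover have "((`) j ` edges ?K) \<inter> ?M = {}"
  proof -
    have "cross {..<k} {k..<n} \<inter> ?M = {}" by (auto simp: cross_def doubleton_eq_iff)
    then show ?thesis using edge by blast
  qed
  moreover have fin: "finite (cross {..<k} {k..<n})" by (simp add: finite_cross)
  then have "finite ((`) j ` edges ?K)" using edge finite_subset by blast
  ultimately have "card (edges ?K) + (n - k) div 2 = card ((`) j ` edges ?K \<union> ?M)"
    by (simp add: card_Un_disjoint)
  also have "\<dots> \<le> card (edges (matched_bipartite k n))"
    using edge fin by (intro card_mono) (auto simp: matched_bipartite_def)
  finally show "card (edges ?K) + (n - k) div 2 \<le> card (edges (matched_bipartite k n))" .
qed

context dominant_pair
begin

lemma k_le_n: "k \<le> n" using n_ge by simp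

text \<open>For excluding forbidden graphs, \<open>c\<close> disjoint edges outside \<open>L\<close>
  are as good as a full matching, because a forbidden graph has at most \<open>c\<close>
  vertices.\<close>

lemma matched_bipartite_free:
  assumes ab: "\<forall>i<c. a i \<in> {..<n} - L \<and> b i \<in> {..<n} - L \<and> {a i, b i} \<in> edges G"
    "inj_on a {..<c}" "inj_on b {..<c}" "\<forall>i<c. \<forall>i'<c. a i \<noteq> b i'"
  shows "matched_bipartite k n \<in> free_graphs n \<F>"
proof -
  have "\<not> contains_subgraph (matched_bipartite k n) F" if F: "F \<in> \<F>" for F
  proof
    assume "contains_subgraph (matched_bipartite k n) F"
    then obtain f where f: "inj_on f (verts F)"
      "\<forall>e\<in>edges F. f ` e \<in> edges (matched_bipartite k n)" "f ` verts F \<subseteq> {..<n}"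
      by (auto elim!: contains_subgraphE simp: matched_bipartite_def)
    have finF: "finite (verts F)" using simple_graph_finite(1)[OF family_simple[OF F]] .
    obtain g where g: "bij_betw g {..<k} L"
      using finite_L card_L by (metis card_lessThan finite_lessThan finite_same_card_bij)
    define V where "V = f ` verts F"
    define I where "I = (\<lambda>y. (y - k) div 2) ` V"
    have finV: "finite V" using finF by (simp add: V_def)
    have "card I \<le> card V" unfolding I_def using finV by (rule card_image_le)
    also have "\<dots> \<le> card (verts F)" unfolding V_def using finF by (rule card_image_le)
    also have "\<dots> \<le> card {..<c}" using family_order[OF F] by simp
    finally obtain t where t: "inj_on t I" "t ` I \<subseteq> {..<c}"
      using card_le_inj[of I "{..<c}"] finV by (auto simp: I_def)
    \<comment> \<open>The copy meets at most \<open>c\<close> of the pairs \<open>k + 2i, k + 2i + 1\<close>, and \<open>t\<close> sends these to distinct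
      matching edges of \<open>G\<close>. An unmatched last vertex counts as half of a pair.\<close>
    define h where "h y = (if y < k then g y
      else if even (y - k) then a (t ((y - k) div 2)) else b (t ((y - k) div 2)))" for y
    have hL: "h y \<in> L" if "y < k" for y using that g by (auto simp: h_def bij_betw_def)
    have tI: "t ((y - k) div 2) < c" if "y \<in> V" for y using t(2) that by (auto simp: I_def)
    have hR: "h y \<in> {..<n} - L" if "y \<in> V" "\<not> y < k" for y
      using that(2) ab(1) tI[OF that(1)] by (auto simp: h_def)
    have injh: "inj_on h V"
    proof (rule inj_onI)
      fix y z assume yz: "y \<in> V" "z \<in> V" "h y = h z"
      have same: "y < k \<longleftrightarrow> z < k" using hL hR yz by (metis DiffD2)
      show "y = z"
      proof (cases "y < k")
        case True
        then have "g y = g z" using yz same by (simp add: h_def)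
        then show ?thesis using g True same by (auto simp: bij_betw_def dest: inj_onD)
      next
        case False
        then have nk: "\<not> y < k" "\<not> z < k" using same by auto
        have par: "even (y - k) \<longleftrightarrow> even (z - k)"
          using yz(3) ab(4) not_sym[OF ab(4)[rule_format]] tI[OF yz(1)] tI[OF yz(2)] nk by (auto simp: h_def split: if_splits)
        then have "t ((y - k) div 2) = t ((z - k) div 2)"
          using yz(3) nk ab(2,3) tI[OF yz(1)] tI[OF yz(2)]
          by (auto simp: h_def split: if_splits dest!: inj_onD)
        then have "(y - k) div 2 = (z - k) div 2"
          using t(1) yz(1,2) by (auto simp: I_def dest: inj_onD)
        moreover have "(y - k) mod 2 = (z - k) mod 2" using par by (simp only: mod2_eq_if)
        ultimately have "y - k = z - k" by (metis div_mult_mod_eq)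
        then show ?thesis using nk by simp
      qed
    qed
    have "contains_subgraph G F"
    proof (rule contains_subgraphI[of "h \<circ> f"])
      show "inj_on (h \<circ> f) (verts F)" using f(1) injh by (simp add: comp_inj_on V_def)
      show "(h \<circ> f) ` verts F \<subseteq> verts G"
      proof
        fix y assume "y \<in> (h \<circ> f) ` verts F"
        then obtain z where "z \<in> V" "y = h z" by (auto simp: V_def)
        then show "y \<in> verts G" using hL[of z] hR[of z] L_sub vertsG by (cases "z < k") auto
      qed
      fix e assume e: "e \<in> edges F"
      then have fe: "f ` e \<subseteq> V" "f ` e \<in> edges (matched_bipartite k n)"
        using simple_graph_finite(2)[OF family_simple[OF F]] f(2) by (auto simp: V_def)
      then consider u v where "u < k" "k \<le> v" "f ` e = {u, v}"
        | i where "f ` e = {k + 2 * i, k + 2 * i + 1}"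
        by (auto simp: matched_bipartite_def cross_def)
      then have "h ` (f ` e) \<in> edges G"
      proof cases
        case (1 u v)
        then have "v \<in> V" using fe(1) by auto
        then have "{h u, h v} \<in> edges G" using 1 hL hR by (intro joined) auto
        then show ?thesis using 1(3) by simp
      next
        case (2 i)
        then have "k + 2 * i \<in> V" using fe(1) by auto
        then have "t i < c" using tI[of "k + 2 * i"] by simp
        moreover have "h ` (f ` e) = {a (t i), b (t i)}" unfolding 2 by (auto simp: h_def)
        ultimately show ?thesis using ab(1) by simp
      qed
      then show "(h \<circ> f) ` e \<in> edges G" by (simp add: image_comp)
    qed
    then show False using G_free F by (auto simp: free_graphs_def)
  qed
  then show ?thesis
    using simple_matched_bipartite[OF k_le_n] by (simp add: free_graphs_def matched_bipartite_def)
qed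

text \<open>This is where the hypothesis on the containing extremal number enters: more edges would
  give \<open>c\<close> disjoint ones, and the matched bipartite graph would be a free graph with
  too many edges.\<close>

lemma few_rest_edges:
  assumes "ex_containing (complete_bipartite k (n - k)) n \<F>
    < card (edges (complete_bipartite k (n - k))) + (n - k) div 2"
  shows "card {a \<in> edges G. a \<subseteq> {..<n} - L} \<le> 2 * c * m"
proof (rule ccontr)
  assume "\<not> ?thesis"
  then have "2 * c * m < card {a \<in> edges G. a \<subseteq> {..<n} - L}" by simp
  from exists_matching[OF simple _ _ this, of c] degree_rest
  obtain a b where "\<forall>i<c. a i \<in> {..<n} - L \<and> b i \<in> {..<n} - L \<and> {a i, b i} \<in> edges G"
    "inj_on a {..<c}" "inj_on b {..<c}" "\<forall>i<c. \<forall>i'<c. a i \<noteq> b i'"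
    using vertsG by (metis Diff_subset less_imp_le order_refl)
  from matched_bipartite_free[OF this]
  have "card (edges (matched_bipartite k n)) \<le> ex_containing (complete_bipartite k (n - k)) n \<F>"
    unfolding ex_containing_def using matched_bipartite_contains(1)[OF k_le_n]
    by (intro Max_ge finite_imageI finite_subset[OF _ finite_free_graphs]) auto
  then show False using matched_bipartite_contains(2)[OF k_le_n] assms by linarith
qed

end

section \<open>Optimality of the two parts\<close>

lemma prod_edge_bounds:
  fixes x :: "'a \<Rightarrow> real"
  assumes G: "simple_graph G" "a \<in> edges G"
  shows "(\<And>i. i \<in> a \<Longrightarrow> r \<le> x i) \<Longrightarrow> 0 \<le> r \<Longrightarrow> r^2 \<le> (\<Prod>i\<in>a. x i)"
    and "(\<And>i. i \<in> a \<Longrightarrow> 0 \<le> x i \<and> x i \<le> r) \<Longrightarrow> (\<Prod>i\<in>a. x i) \<le> r^2"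
proof -
  obtain u v where uv: "u \<noteq> v" "a = {u, v}" using G by (rule simple_graphE)
  then have p: "(\<Prod>i\<in>a. x i) = x u * x v" by simp
  show "r^2 \<le> (\<Prod>i\<in>a. x i)" if "\<And>i. i \<in> a \<Longrightarrow> r \<le> x i" "0 \<le> r"
    unfolding p power2_eq_square using that(1)[of u] that(1)[of v] that(2) uv(2)
    by (intro mult_mono) auto
  show "(\<Prod>i\<in>a. x i) \<le> r^2" if "\<And>i. i \<in> a \<Longrightarrow> 0 \<le> x i \<and> x i \<le> r"
    unfolding p power2_eq_square using that[of u] that[of v] uv(2)
    by (intro mult_mono) auto
qed

context dominant_pair
begin

abbreviation "rest_edges G' \<equiv> {a \<in> edges G'. a \<subseteq> {..<n} - L}"

lemma sum_edges_join:
  fixes g :: "nat set \<Rightarrow> 'b::comm_monoid_add"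
  assumes "simple_graph G'" "verts G' = {..<n}" "cross L ({..<n} - L) \<subseteq> edges G'"
  shows "sum g (edges G')
    = sum g {a\<in>edges G'. a \<subseteq> L} + sum g (cross L ({..<n} - L)) + sum g (rest_edges G')"
  using assms L_sub by (intro sum_edges_split) auto

text \<open>Replacing \<open>G\<close> by \<open>join_on n T\<close> gains an edge inside
  \<open>L\<close>. The deviation of the weights from 1 costs at most \<open>2 * e\<close> on each
  of at most \<open>k^2\<close> edges, and deleting the edges outside \<open>L\<close> costs at most
  \<open>2 * c * m * e\<close>. By \<open>e_edges\<close> the total loss is below 1.\<close>

lemma card_L_edges_maximal:
  assumes few: "card (rest_edges G) \<le> 2 * c * m"
    and T: "simple_graph T" "verts T = L" "core_free \<F> k T"
  shows "card (edges T) \<le> card {a \<in> edges G. a \<subseteq> L}"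
proof (rule ccontr)
  let ?EL = "{a \<in> edges G. a \<subseteq> L}"
  assume "\<not> ?thesis"
  then have less: "real (card ?EL) + 1 \<le> card (edges T)" by linarith
  let ?w = "\<lambda>a. \<Prod>i\<in>a. x i" and ?J = "join_on n T"
  have J: "?J \<in> free_graphs n \<F>" using T L_sub card_L by (intro join_on_free) auto
  then have sJ: "simple_graph ?J" by (simp add: free_graphs_def)
  have "1 * e \<le> (m + 2 * C + 1) * e" using e_pos family_C by (intro mult_right_mono) auto
  then have e1: "e < 1" using e_common by simp
  have JL: "{a \<in> edges ?J. a \<subseteq> L} = edges T"
    using simple_graph_finite(2)[OF T(1)] T(2) by (auto simp: cross_def)
  have JR: "rest_edges ?J = {}"
  proof -
    have "a \<inter> L \<noteq> {}" if "a \<in> edges ?J" for a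
      using that simple_graphE[OF T(1), of a] T(2) by (auto simp: cross_def)
    then show ?thesis by blast
  qed
  have "sum ?w (edges ?J)
      = sum ?w {a \<in> edges ?J. a \<subseteq> L} + sum ?w (cross L ({..<n} - L)) + sum ?w (rest_edges ?J)"
    using T(2) by (intro sum_edges_join[OF sJ]) auto
  then have "edge_weight ?J x = sum ?w (edges T) + sum ?w (cross L ({..<n} - L))"
    unfolding edge_weight_def JL JR by (simp only: sum.empty add_0_right)
  moreover have "edge_weight G x = sum ?w ?EL + sum ?w (cross L ({..<n} - L)) + sum ?w (rest_edges G)"
    unfolding edge_weight_def by (rule sum_edges_join[OF simple vertsG cross_subset])
  moreover have "card (edges T) * (1 - 2 * e) \<le> sum ?w (edges T)"
  proof -
    have "1 - 2 * e \<le> ?w a" if a: "a \<in> edges T" for a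
    proof -
      have "1 - 2 * e \<le> (1 - e)^2" by (simp add: power2_eq_square algebra_simps)
      also have "\<dots> \<le> ?w a"
        using x_L simple_graph_finite(2)[OF T(1) a] T(2) e1 by (intro prod_edge_bounds(1)[OF T(1) a]) auto
      finally show ?thesis .
    qed
    then have "(\<Sum>a\<in>edges T. 1 - 2 * e) \<le> sum ?w (edges T)" by (rule sum_mono)
    then show ?thesis by simp
  qed
  moreover have "sum ?w ?EL \<le> card ?EL"
  proof -
    have "?w a \<le> 1" if "a \<in> ?EL" for a
    proof -
      have "?w a \<le> 1^2" using that x_nonneg x_le L_sub by (intro prod_edge_bounds(2)[OF simple]) auto
      then show ?thesis by simp
    qed
    then have "sum ?w ?EL \<le> (\<Sum>a\<in>?EL. 1)" by (rule sum_mono)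
    then show ?thesis by simp
  qed
  moreover have "sum ?w (rest_edges G) \<le> 2 * real c * m * e"
  proof -
    have "?w a \<le> e" if "a \<in> rest_edges G" for a
    proof -
      have "?w a \<le> e^2" using that x_nonneg x_small by (intro prod_edge_bounds(2)[OF simple]) auto
      also have "\<dots> \<le> e" using e_pos e1 by (simp add: power2_eq_square mult_left_le)
      finally show ?thesis .
    qed
    then have "sum ?w (rest_edges G) \<le> (\<Sum>a\<in>rest_edges G. e)" by (rule sum_mono)
    also have "\<dots> = card (rest_edges G) * e" by simp
    also have "\<dots> \<le> real (2 * c * m) * e" using few e_pos by (intro mult_right_mono of_nat_mono) auto
    finally show ?thesis by simp
  qed
  moreover have "real (card (edges T)) * (2 * e) \<le> (real k)^2 * (2 * e)"
  proof -
    have "card (edges T) \<le> k^2" using card_edges_le[OF T(1)] T(2) card_L by simp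
    then have "real (card (edges T)) \<le> (real k)^2" by (metis of_nat_mono of_nat_power)
    then show ?thesis using e_pos by (intro mult_right_mono) auto
  qed
  ultimately have "edge_weight G x < edge_weight ?J x"
    using less e_edges by (simp add: algebra_simps)
  then show False using edge_weight_free_le[OF J] by simp
qed

text \<open>Outside \<open>L\<close> the eigenvalue equation reads \<open>lam * x v = s\<close> plus
  the weights of fewer than \<open>m\<close> neighbours outside \<open>L\<close>. Hence all these
  weights are nearly equal.\<close>

lemma rest_weights:
  fixes s lam :: real
  defines "s \<equiv> \<Sum>j\<in>L. x j" and "lam \<equiv> largest_eigenvalue n G"
  shows "0 < s" "v \<in> {..<n} - L \<Longrightarrow> s / lam \<le> x v" "v \<in> {..<n} - L \<Longrightarrow> x v \<le> s / (lam - m)"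
    "m < lam"
proof -
  let ?R = "{..<n} - L"
  have "1 * e \<le> (m + 2 * C + 1) * e" using e_pos family_C by (intro mult_right_mono) auto
  then have e1: "e < 1" using e_common by simp
  have "L \<noteq> {}" using card_L k_pos by auto
  moreover have "0 < x j" if "j \<in> L" for j using x_L[OF that] e1 by linarith
  ultimately show "0 < s" unfolding s_def using finite_L by (intro sum_pos) auto
  have "1 * real m \<le> 2 * (2 * real c * m + 1) * m" by (intro mult_right_mono) auto
  then show mlam: "m < lam" using lam_large unfolding lam_def by linarith
  have split: "lam * x v = s + (\<Sum>j\<in>nbrs G v \<inter> ?R. x j)" if v: "v \<in> ?R" for v
  proof -
    have "v \<in> common_nbrs G L" using v by (simp add: full_join)
    then have "L \<subseteq> nbrs G v" by (simp add: common_nbrs_def)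
    then have "nbrs G v = L \<union> (nbrs G v \<inter> ?R)" using nbrs_subset[of v] by auto
    then have "(\<Sum>j\<in>nbrs G v. x j) = (\<Sum>j\<in>L \<union> (nbrs G v \<inter> ?R). x j)" by simp
    also have "\<dots> = s + (\<Sum>j\<in>nbrs G v \<inter> ?R. x j)"
      unfolding s_def using finite_L by (intro sum.union_disjoint) auto
    finally show ?thesis using eigen[of v] v unfolding lam_def by auto
  qed
  have lam0: "0 < lam" unfolding lam_def by (rule lam_pos)
  show "s / lam \<le> x v" if v: "v \<in> ?R"
  proof -
    have "0 \<le> (\<Sum>j\<in>nbrs G v \<inter> ?R. x j)" using x_nonneg by (intro sum_nonneg) auto
    then show ?thesis using split[OF v] lam0 by (simp add: field_simps)
  qed
  show "x v \<le> s / (lam - m)" if v: "v \<in> ?R"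
  proof -
    \<comment> \<open>At a heaviest vertex outside \<open>L\<close> the equation bounds
      \<open>u\<close> in terms of itself: \<open>lam * u \<le> s + m * u\<close>.\<close>
    define u where "u = Max (x ` ?R)"
    have "u \<in> x ` ?R" unfolding u_def using v by (intro Max_in) auto
    then obtain z where z: "z \<in> ?R" "x z = u" by auto
    have le: "x j \<le> u" if "j \<in> ?R" for j unfolding u_def using that by (intro Max_ge) auto
    have "(\<Sum>j\<in>nbrs G z \<inter> ?R. x j) \<le> (\<Sum>j\<in>nbrs G z \<inter> ?R. u)" using le by (intro sum_mono) auto
    also have "\<dots> = card (nbrs G z \<inter> ?R) * u" by simp
    also have "\<dots> \<le> m * u"
      using degree_rest[OF z(1)] x_nonneg[of z] z(2) by (intro mult_right_mono) auto
    finally have "lam * u \<le> s + m * u" using split[OF z(1)] z(2) by simp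
    then have "u \<le> s / (lam - m)" using mlam by (simp add: field_simps)
    then show ?thesis using le[OF v] by linarith
  qed
qed

text \<open>Inside \<open>L\<close> the graph \<open>G'\<close> cannot have more edges than
  \<open>G\<close>, so it agrees with \<open>G\<close> there and its surplus lies outside
  \<open>L\<close>. There all edges have nearly the same weight and \<open>G\<close> has only
  boundedly many, so one more edge outweighs the differences.\<close>

lemma card_edges_maximal:
  assumes few: "card (rest_edges G) \<le> 2 * c * m"
    and G': "G' \<in> free_graphs n \<F>" "cross L ({..<n} - L) \<subseteq> edges G'"
      "{a \<in> edges G. a \<subseteq> L} \<subseteq> edges G'"
  shows "card (edges G') \<le> card (edges G)"
proof (rule ccontr)
  assume "\<not> ?thesis"
  then have less: "card (edges G) < card (edges G')" by simp
  have sG': "simple_graph G'" "verts G' = {..<n}" using G'(1) by (auto simp: free_graphs_def)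
  let ?I = "induced_subgraph G' L"
  have "core_free \<F> k ?I"
  proof (rule core_free_of_free[OF family_simple sG'(1)])
    show "\<not> contains_subgraph G' F" if "F \<in> \<F>" for F using that G'(1) by (simp add: free_graphs_def)
    show "card (verts F) \<le> card (verts G' - L)" if "F \<in> \<F>" for F
      using family_order[OF that] card_rest sG'(2) by simp
    show "{u, v} \<in> edges G'" if "u \<in> L" "v \<in> verts G' - L" for u v
      using that G'(2) sG'(2) unfolding cross_def by auto
  qed (use sG'(2) L_sub in auto)
  then have "card (edges ?I) \<le> card {a \<in> edges G. a \<subseteq> L}"
    using simple_induced[OF sG'(1)] L_sub sG'(2) by (intro card_L_edges_maximal[OF few]) auto
  moreover have "{a \<in> edges G. a \<subseteq> L} \<subseteq> edges ?I" using G'(3) by auto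
  moreover have "finite (edges ?I)" using finite_edges[OF sG'(1)] by simp
  ultimately have EL: "{a \<in> edges G'. a \<subseteq> L} = {a \<in> edges G. a \<subseteq> L}"
    using card_seteq[of "edges ?I" "{a \<in> edges G. a \<subseteq> L}"] by simp
  define q where "q = card (rest_edges G)"
  have more: "q + 1 \<le> card (rest_edges G')"
    using sum_edges_join[OF simple vertsG cross_subset, of "\<lambda>_. 1 :: nat"]
      sum_edges_join[OF sG' G'(2), of "\<lambda>_. 1 :: nat"] less EL by (simp add: q_def)
  let ?w = "\<lambda>a. \<Prod>i\<in>a. x i"
  define s where "s = (\<Sum>j\<in>L. x j)"
  define lam where "lam = largest_eigenvalue n G"
  note rw = rest_weights[folded s_def lam_def]
  have lam0: "0 < lam" unfolding lam_def by (rule lam_pos)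
  have "real (q + 1) * (s / lam)^2 \<le> card (rest_edges G') * (s / lam)^2"
    using more by (intro mult_right_mono of_nat_mono) auto
  also have "\<dots> = (\<Sum>a\<in>rest_edges G'. (s / lam)^2)" by simp
  also have "\<dots> \<le> sum ?w (rest_edges G')"
  proof (rule sum_mono)
    fix a assume "a \<in> rest_edges G'"
    then show "(s / lam)^2 \<le> ?w a"
      using rw(1,2) lam0 by (intro prod_edge_bounds(1)[OF sG'(1)]) auto
  qed
  finally have upper: "real (q + 1) * (s / lam)^2 \<le> sum ?w (rest_edges G')" .
  have "sum ?w (rest_edges G) \<le> (\<Sum>a\<in>rest_edges G. (s / (lam - m))^2)"
  proof (rule sum_mono)
    fix a assume "a \<in> rest_edges G"
    then show "?w a \<le> (s / (lam - m))^2"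
      using rw(3) x_nonneg by (intro prod_edge_bounds(2)[OF simple]) auto
  qed
  then have lower: "sum ?w (rest_edges G) \<le> q * (s / (lam - m))^2" by (simp add: q_def)
  have "edge_weight G' x \<le> edge_weight G x" by (rule edge_weight_free_le[OF G'(1)])
  then have "sum ?w (rest_edges G') \<le> sum ?w (rest_edges G)"
    unfolding edge_weight_def sum_edges_join[OF simple vertsG cross_subset, of ?w]
      sum_edges_join[OF sG' G'(2), of ?w] EL by simp
  then have "real (q + 1) * (s / lam)^2 \<le> q * (s / (lam - m))^2" using upper lower by linarith
  then have "s^2 * (real (q + 1) * (lam - m)^2) \<le> s^2 * (q * lam^2)"
    using lam0 rw(4) by (simp add: power_divide field_simps)
  then have "real (q + 1) * (lam - m)^2 \<le> q * lam^2"
    using rw(1) by (subst (asm) mult_le_cancel_left_pos) auto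
  \<comment> \<open>Expanding the squares leaves \<open>lam^2 \<le> 2 * (q + 1) * m * lam\<close> up
    to a nonnegative term; as \<open>q \<le> 2 * c * m\<close>, this is what
    \<open>lam_large\<close> excludes.\<close>
  then have le: "lam * lam + real (q + 1) * (real m)^2 \<le> lam * (2 * real (q + 1) * m)"
    by (simp add: power2_eq_square algebra_simps)
  have "2 * real (q + 1) * m \<le> 2 * (2 * real c * m + 1) * m"
  proof -
    have "real q \<le> real (2 * c * m)" using few unfolding q_def by (rule of_nat_mono)
    then show ?thesis by (intro mult_right_mono) auto
  qed
  also have "\<dots> < lam" using lam_large by (simp add: lam_def)
  finally have "lam * (2 * real (q + 1) * m) < lam * lam" using lam0 by simp
  moreover have "0 \<le> real (q + 1) * (real m)^2" by simp
  ultimately show False using le by linarith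
qed

end

section \<open>Membership in the extremal family\<close>

context dominant_pair
begin

text \<open>The join has exactly \<open>n\<close> vertices, so its copy in \<open>G'\<close> spans
  everything and defines a permutation of \<open>{..<n}\<close>. Undoing this permutation puts the
  copy in the position it has in \<open>G\<close>, where \<open>card_edges_maximal\<close>
  applies.\<close>

lemma competitor_le:
  assumes few: "card (rest_edges G) \<le> 2 * c * m"
    and h: "bij_betw h L {..<k}"
    and G': "G' \<in> free_graphs n \<F>"
      "contains_subgraph G' (join (map_graph h (induced_subgraph G L)) (edgeless_graph (n - k)))"
  shows "card (edges G') \<le> card (edges G)"
proof -
  let ?T = "map_graph h (induced_subgraph G L)"
  let ?H = "join ?T (edgeless_graph (n - k))"
  let ?R = "{..<n} - L"
  have sG': "simple_graph G'" "verts G' = {..<n}" using G'(1) by (auto simp: free_graphs_def)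
  obtain f where f: "inj_on f (verts ?H)" "f ` verts ?H \<subseteq> {..<n}" "\<forall>a\<in>edges ?H. f ` a \<in> edges G'"
    using G'(2) sG'(2) by (auto elim!: contains_subgraphE)
  have vH: "verts ?H = {..<k} <+> {..<n - k}"
    using h by (simp add: join_def edgeless_graph_def bij_betw_def)
  have "card ?R = n - k" using L_sub finite_L card_L by (simp add: card_Diff_subset)
  then obtain r where r: "bij_betw r ?R {..<n - k}"
    by (metis card_lessThan finite_Diff finite_lessThan finite_same_card_bij)
  \<comment> \<open>\<open>g\<close> identifies \<open>{..<n}\<close> with the vertices of the join,
    sending \<open>L\<close> to its core; \<open>p\<close> is the resulting permutation.\<close>
  define g where "g v = (if v \<in> L then Inl (h v) else Inr (r v))" for v
  define p where "p = f \<circ> g"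
  have inj_g: "inj_on g {..<n}"
    using h r by (auto simp: inj_on_def g_def bij_betw_def)
  have im_g: "g ` {..<n} \<subseteq> verts ?H"
    unfolding vH using h r by (auto simp: g_def bij_betw_def)
  have inj_p: "inj_on p {..<n}"
    unfolding p_def using inj_g im_g f(1) by (meson comp_inj_on inj_on_subset)
  have im_p: "p ` {..<n} \<subseteq> {..<n}" unfolding p_def using im_g f(2) by auto
  have bij_p: "bij_betw p {..<n} {..<n}"
    unfolding bij_betw_def using inj_p im_p by (simp add: endo_inj_surj)
  define z where "z = inv_into {..<n} p"
  have bij_z: "bij_betw z {..<n} {..<n}" unfolding z_def using bij_p by (rule bij_betw_inv_into)
  let ?G = "map_graph z G'"
  have free: "?G \<in> free_graphs n \<F>"
    using G'(1) sG' bij_z by (intro free_graphs_map) (auto simp: free_graphs_def)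
  have pull: "a \<in> edges ?G" if "a \<subseteq> {..<n}" "p ` a \<in> edges G'" for a
  proof -
    have "z ` (p ` a) = a" unfolding z_def using inj_p that(1) by (rule inv_into_image_cancel)
    then show ?thesis using that(2) by (metis imageI map_graph_simps(2))
  qed
  have "cross L ?R \<subseteq> edges ?G"
  proof
    fix a assume "a \<in> cross L ?R"
    then obtain u v where uv: "u \<in> L" "v \<in> ?R" "a = {u, v}" unfolding cross_def by blast
    then have "h u \<in> {..<k}" "r v \<in> {..<n - k}" using h r by (auto simp: bij_betw_def)
    then have "{Inl (h u), Inr (r v)} \<in> edges ?H"
      using h by (auto simp: join_def edgeless_graph_def bij_betw_def)
    then have "f ` {Inl (h u), Inr (r v)} \<in> edges G'" using f(3) by blast
    then have "p ` a \<in> edges G'" using uv by (simp add: p_def g_def)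
    moreover have "a \<subseteq> {..<n}" using uv L_sub by auto
    ultimately show "a \<in> edges ?G" by (intro pull)
  qed
  moreover have "{a \<in> edges G. a \<subseteq> L} \<subseteq> edges ?G"
  proof
    fix a assume a: "a \<in> {a \<in> edges G. a \<subseteq> L}"
    then have "Inl ` h ` a \<in> edges ?H" by (auto simp: join_def)
    then have "f ` Inl ` h ` a \<in> edges G'" using f(3) by blast
    moreover have "p ` a = f ` Inl ` h ` a"
      unfolding image_image p_def using a by (intro image_cong) (auto simp: g_def)
    ultimately show "a \<in> edges ?G" using a L_sub by (intro pull) auto
  qed
  ultimately have "card (edges ?G) \<le> card (edges G)" by (rule card_edges_maximal[OF few free])
  moreover have "card (edges ?G) = card (edges G')"
    using bij_z sG' by (intro card_edges_map_graph) (auto simp: bij_betw_def)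
  ultimately show ?thesis by simp
qed

text \<open>The member of \<open>G0_family\<close> is built from \<open>G[L]\<close>, relabelled to
  \<open>{..<k}\<close>. It is edge-maximal by \<open>card_L_edges_maximal\<close>, and
  \<open>G\<close> is edge-maximal among the free graphs containing its join by
  \<open>competitor_le\<close>.\<close>

lemma extremal_in_G_family:
  assumes beta: "family_beta' \<F> = enat (Suc k)"
    and ex: "ex_containing (complete_bipartite k (n - k)) n \<F>
      < card (edges (complete_bipartite k (n - k))) + (n - k) div 2"
  shows "G \<in> G_family n \<F>"
proof -
  have few: "card (rest_edges G) \<le> 2 * c * m" using few_rest_edges[OF ex] .
  obtain h where h: "bij_betw h L {..<k}"
    using finite_L card_L by (metis card_lessThan finite_lessThan finite_same_card_bij)
  let ?I = "induced_subgraph G L"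
  let ?T = "map_graph h ?I"
  let ?H = "join ?T (edgeless_graph (n - k))"
  let ?R = "{..<n} - L"
  have sI: "simple_graph ?I" using simple L_sub vertsG by (intro simple_induced) auto
  have injI: "inj_on h (verts ?I)" using h by (simp add: bij_betw_def)
  have vT: "verts ?T = {..<k}" using h by (simp add: bij_betw_def)
  have sT: "simple_graph ?T" using sI injI by (rule simple_map_graph)
  have T_free: "?T \<in> free_graphs k (H_family \<F>)"
  proof -
    have "core_free \<F> k ?T"
    proof (rule core_free_contains)
      have "contains_subgraph ?I ?T" using sI injI by (rule map_graph_contained)
      then show "contains_subgraph ?I ?T" .
    qed (rule core_free_L)
    then have "\<forall>X\<in>H_family \<F>. \<not> contains_subgraph ?T X"
      using H_family_free_iff[OF beta, of ?T] vT by simp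
    then show ?thesis using sT vT by (simp add: free_graphs_def)
  qed
  have T_max: "card (edges T') \<le> card (edges ?T)" if T': "T' \<in> free_graphs k (H_family \<F>)" for T'
  proof -
    have sT': "simple_graph T'" "verts T' = {..<k}" using T' by (auto simp: free_graphs_def)
    have core: "core_free \<F> k T'"
      using H_family_free_iff[OF beta, of T'] sT'(2) T' by (simp add: free_graphs_def)
    define i where "i = inv_into L h"
    have i: "bij_betw i {..<k} L" unfolding i_def using h by (rule bij_betw_inv_into)
    then have inji: "inj_on i (verts T')" using sT'(2) by (simp add: bij_betw_def)
    have "card (edges (map_graph i T')) \<le> card {a \<in> edges G. a \<subseteq> L}"
    proof (rule card_L_edges_maximal[OF few])
      show "simple_graph (map_graph i T')" using sT'(1) inji by (rule simple_map_graph)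
      show "verts (map_graph i T') = L" using i sT'(2) by (simp add: bij_betw_def)
      show "core_free \<F> k (map_graph i T')"
        using core map_graph_contained[OF sT'(1) inji] by (rule core_free_contains)
    qed
    then show ?thesis
      using card_edges_map_graph[OF sT'(1) inji] card_edges_map_graph[OF sI injI] by simp
  qed
  have "ex k (H_family \<F>) = card (edges ?T)"
    unfolding ex_def
  proof (rule Max_eqI)
    show "card (edges ?T) \<in> (\<lambda>G. card (edges G)) ` free_graphs k (H_family \<F>)"
      using T_free by (rule imageI)
  qed (use T_max finite_free_graphs in auto)
  then have T: "?T \<in> Ex_set k (H_family \<F>)" using T_free by (simp add: Ex_set_def)
  have contains: "contains_subgraph G ?H"
  proof -
    have "card ?R = n - k" using L_sub finite_L card_L by (simp add: card_Diff_subset)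
    then obtain r where r: "bij_betw r {..<n - k} ?R"
      by (metis card_lessThan finite_Diff finite_lessThan finite_same_card_bij)
    define i where "i = inv_into L h"
    have i: "bij_betw i {..<k} L" unfolding i_def using h by (rule bij_betw_inv_into)
    have ih: "i ` (h ` a) = a" if "a \<subseteq> L" for a
      unfolding i_def using h that by (intro inv_into_image_cancel) (auto simp: bij_betw_def)
    have vH: "verts ?H = {..<k} <+> {..<n - k}"
      using h by (simp add: join_def edgeless_graph_def bij_betw_def)
    let ?f = "case_sum i r"
    show ?thesis
    proof (rule contains_subgraphI[of ?f])
      have disj: "i u \<noteq> r v" if "u < k" "v < n - k" for u v
      proof -
        have "i u \<in> L" "r v \<in> ?R" using i r that by (auto simp: bij_betw_def)
        then show ?thesis by auto
      qed
      show "inj_on ?f (verts ?H)"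
        unfolding vH
      proof (rule inj_onI)
        fix y z assume "y \<in> {..<k} <+> {..<n - k}" "z \<in> {..<k} <+> {..<n - k}" "?f y = ?f z"
        then show "y = z"
          using i r disj not_sym[OF disj] by (auto simp: bij_betw_def dest: inj_onD)
      qed
      show "?f ` verts ?H \<subseteq> verts G"
        unfolding vH vertsG using i r L_sub by (auto simp: bij_betw_def)
      fix a assume "a \<in> edges ?H"
      then consider b where "b \<in> edges G" "b \<subseteq> L" "a = Inl ` h ` b"
        | u v where "u \<in> L" "v < n - k" "a = {Inl (h u), Inr v}"
        by (auto simp: join_def edgeless_graph_def)
      then show "?f ` a \<in> edges G"
      proof cases
        case 1
        have "?f ` a = i ` (h ` b)" unfolding 1(3) by (simp add: image_image)
        then show ?thesis using ih[OF 1(2)] 1(1) by simp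
      next
        case 2
        have "i (h u) \<in> L" "r v \<in> ?R" using 2 h i r by (auto simp: bij_betw_def)
        then show ?thesis using joined 2(3) by simp
      qed
    qed
  qed
  have "ex_containing ?H n \<F> = card (edges G)"
    unfolding ex_containing_def
  proof (rule Max_eqI)
    show "finite ((\<lambda>G. card (edges G)) ` {G \<in> free_graphs n \<F>. contains_subgraph G ?H})"
      by (intro finite_imageI finite_subset[OF _ finite_free_graphs]) auto
  qed (use competitor_le[OF few h] G_free contains in auto)
  then have "G \<in> Ex_containing ?H n \<F>" using G_free contains by (simp add: Ex_containing_def)
  moreover have "?H \<in> G0_family n \<F>" using T unfolding G0_family_def beta by auto
  ultimately show ?thesis unfolding G_family_def by blast
qed

end

text \<open>Some member has an independent covering of exactly \<open>k + 1\<close> vertices. Its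
  order can serve as \<open>m\<close>, since \<open>k + 1\<close> vertices with that many common
  neighbours would produce a copy of it.\<close>

lemma finite_degenerate_imp_degenerate_family:
  assumes F: "\<forall>F\<in>\<F>. simple_graph F" and deg: "finite_degenerate \<F>"
    and b2: "family_beta' \<F> \<ge> 2" and lin: "(\<lambda>n. real (ex n \<F>)) \<in> O(\<lambda>n. real n)"
  obtains k m c C where "family_beta' \<F> = enat (Suc k)" "degenerate_family \<F> k m c C"
proof -
  obtain F\<^sub>1 where F1: "F\<^sub>1 \<in> \<F>" "bipartite F\<^sub>1"
    using deg by (auto simp: finite_degenerate_def degenerate_def)
  obtain c where c: "\<forall>F\<in>\<F>. card (verts F) \<le> c" using deg by (auto simp: finite_degenerate_def)
  \<comment> \<open>Extended naturals are well-ordered, so the infimum over a nonempty family is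
    attained; the same holds below for the coverings of \<open>F\<^sub>0\<close>.\<close>
  have "family_beta' \<F> \<in> beta' ` \<F>"
    unfolding family_beta'_def using F1(1) by (intro wellorder_InfI) auto
  then obtain F\<^sub>0 where F0: "F\<^sub>0 \<in> \<F>" "beta' F\<^sub>0 = family_beta' \<F>" by auto
  have "beta' F\<^sub>1 \<noteq> \<infinity>" using beta'_eq_infinity_iff F1 F by blast
  moreover have "family_beta' \<F> \<le> beta' F\<^sub>1"
    unfolding family_beta'_def using F1(1) by (rule INF_lower)
  ultimately have "family_beta' \<F> \<noteq> \<infinity>" by (metis enat_ord_simps(5))
  then obtain b where b: "family_beta' \<F> = enat b" by auto
  then have "2 \<le> b" using b2 by (simp add: numeral_eq_enat)
  then obtain k where k: "b = Suc k" "1 \<le> k" by (cases b) auto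
  let ?X = "{S. covering F\<^sub>0 S \<and> independent_set F\<^sub>0 S}"
  have "?X \<noteq> {}"
  proof
    assume "?X = {}"
    then have "beta' F\<^sub>0 = \<infinity>"
      unfolding beta'_def by (simp only: image_empty Inf_empty top_enat_def)
    then show False using F0(2) b by simp
  qed
  then obtain S\<^sub>1 where "S\<^sub>1 \<in> ?X" by blast
  then have "beta' F\<^sub>0 \<in> (\<lambda>S. enat (card S)) ` ?X"
    unfolding beta'_def by (intro wellorder_InfI[of "enat (card S\<^sub>1)"] imageI)
  then obtain S\<^sub>0 where S0: "covering F\<^sub>0 S\<^sub>0" "independent_set F\<^sub>0 S\<^sub>0" "card S\<^sub>0 = Suc k"
    using F0(2) b k by auto
  obtain C :: real where C: "1 \<le> C" "\<forall>n. \<forall>G\<in>free_graphs n \<F>. real (card (edges G)) \<le> C * n"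
    using free_graphs_linear[OF lin] by blast
  have "degenerate_family \<F> k (card (verts F\<^sub>0)) c C"
  proof
    show "k < card S" if "F \<in> \<F>" "covering F S" "independent_set F S" for F S
    proof -
      have "family_beta' \<F> \<le> beta' F" unfolding family_beta'_def using that(1) by (rule INF_lower)
      also have "\<dots> \<le> enat (card S)" unfolding beta'_def using that by (intro INF_lower) auto
      finally show ?thesis using b k by simp
    qed
    show "card (common_nbrs G S) < card (verts F\<^sub>0)"
      if "G \<in> free_graphs n \<F>" "S \<subseteq> {..<n}" "card S = Suc k" for n G S
    proof (rule ccontr)
      assume "\<not> ?thesis"
      then have "contains_subgraph G F\<^sub>0"
        using that F F0(1) S0 by (intro contains_of_common_nbrs[of F\<^sub>0 S\<^sub>0 G S]) (auto simp: free_graphs_def)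
      then show False using that(1) F0(1) by (simp add: free_graphs_def)
    qed
  qed (use F c C k in auto)
  then show ?thesis using that b k by blast
qed

theorem theorem1p1:
  fixes \<F> :: "nat sgraph set"
  assumes "\<forall>F\<in>\<F>. simple_graph F"
    and "finite_degenerate \<F>"
    and "family_beta' \<F> \<ge> 2"
    and "(\<lambda>n. real (ex n \<F>)) \<in> O(\<lambda>n. real n)"
  shows "\<forall>\<^sub>F n in sequentially.
           let b = the_enat (family_beta' \<F>);
               H = complete_bipartite (b - 1) (n + 1 - b)
           in ex_containing H n \<F> < card (edges H) + (n + 1 - b) div 2
                \<longrightarrow> Ex_sp n \<F> \<subseteq> G_family n \<F>"
proof -
  obtain k m c C where beta: "family_beta' \<F> = enat (Suc k)" and fam: "degenerate_family \<F> k m c C"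
    using assms by (rule finite_degenerate_imp_degenerate_family)
  interpret degenerate_family \<F> k m c C by (rule fam)
  \<comment> \<open>The denominator exceeds both coefficients by which \<open>e\<close> is
    multiplied in the two smallness conditions.\<close>
  define e where "e = 1 / (m + 2 * C + 2 * (real k)^2 + 2 * c * m + 2)"
  have pos: "0 < m + 2 * C + 2 * (real k)^2 + 2 * c * m + 2"
    using family_C by (intro add_nonneg_pos add_nonneg_nonneg) auto
  have "0 < e" "(m + 2 * C + 1) * e < 1" "(2 * (real k)^2 + 2 * c * m) * e < 1"
    using pos family_C unfolding e_def by (simp_all add: divide_less_eq add_nonneg_pos add_pos_nonneg)
  from eventually_dominant_pair[OF this] show ?thesis
  proof eventually_elim
    case (elim n)
    have "G \<in> G_family n \<F>"
      if ex: "ex_containing (complete_bipartite k (n - k)) n \<F>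
        < card (edges (complete_bipartite k (n - k))) + (n - k) div 2" and G: "G \<in> Ex_sp n \<F>" for G
    proof -
      obtain x L where "dominant_pair \<F> k m c C G n x L e" using elim G by blast
      then show ?thesis using dominant_pair.extremal_in_G_family[OF _ beta ex] by blast
    qed
    \<comment> \<open>With \<open>b = Suc k\<close>, the expressions \<open>b - 1\<close> and
      \<open>n + 1 - b\<close> become \<open>k\<close> and \<open>n - k\<close>, also in truncated
      subtraction.\<close>
    then show ?case by (auto simp: beta Let_def)
  qed
qed

end
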